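(* Let $C$ and $D$ be coalgebras over a field $k$, let $\Psi'\in\mathsf{Tw}$, and let $\Psi=\Psi'\circ\tau: C\otimes D\to D\otimes C$ and $\phi_\Psi=(\varepsilon_D\otimes\varepsilon_C)\circ\Psi: C\otimes D\to k$. Then the twisted coproduct $\Delta_\Psi$ on $C\otimes D$ admits a counit if and only if $\phi_\Psi$ is invertible with respect to the convolution product, and in that case the convolution inverse $\phi_\Psi^{-1}$ is the counit of $\Delta_\Psi$.
   Context: All coalgebras are coassociative and counital over the field $k$, with Sweedler notation $\Delta(c)=c_{(1)}\otimes c_{(2)}$; $\tau: C\otimes D\to D\otimes C$ is the flip. $\mathsf{Tw}$ is the set of $k$-linear maps $\Psi': D\otimes C\to D\otimes C$ with $(\Delta_D\otimes\mathrm{id}_C)\Psi'=(\mathrm{id}_D\otimes\Psi')(\Delta_D\otimes\mathrm{id}_C)$ and $(\mathrm{id}_D\otimes\Delta_C)\Psi'=(\Psi'\otimes\mathrm{id}_C)(\mathrm{id}_D\otimes\Delta_C)$. The twisted coproduct is $\Delta_\Psi:=(\mathrm{id}_C\otimes\Psi\otimes\mathrm{id}_D)\circ(\Delta_C\otimes\Delta_D)$; a counit for it is a functional $\varepsilon_\Psi: C\otimes D\to k$ with $(\varepsilon_\Psi\otimes\mathrm{id})\Delta_\Psi=\mathrm{id}_{C\otimes D}=(\mathrm{id}\otimes\varepsilon_\Psi)\Delta_\Psi$. The convolution product of functionals on $C\otimes D$ is $(\phi\ast\phi')(c\otimes d)=\phi(c_{(1)}\otimes d_{(1)})\,\phi'(c_{(2)}\otimes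 d_{(2)})$, with unit $\varepsilon_C\otimes\varepsilon_D$. *)

theory Defs
  imports "HOL-Algebra.AbelCoset" "Jordan_Normal_Form.Missing_VectorSpace"
begin

section \<open>Tensor products of vector spaces\<close>

text \<open>Vector spaces are given by carriers, as in the locale \<^locale>\<open>vectorspace\<close>. The
  tensor product is the free vector space on the product of the carriers modulo the bilinearity
  relations.\<close>

definition free_vs :: "('k, 'x) ring_scheme \<Rightarrow> 's set \<Rightarrow> ('k, 's \<Rightarrow> 'k) module" where
  "free_vs K S = ring.func_space K S
     \<lparr>carrier := {f \<in> carrier (ring.func_space K S). finite {s \<in> S. f s \<noteq> \<zero>\<^bsub>K\<^esub>}}\<rparr>"

definition free_gen :: "('k, 'x) ring_scheme \<Rightarrow> 's set \<Rightarrow> 's \<Rightarrow> 's \<Rightarrow> 'k" where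
  "free_gen K S s = (\<lambda>t\<in>S. if t = s then \<one>\<^bsub>K\<^esub> else \<zero>\<^bsub>K\<^esub>)"

text \<open>The fields \<^const>\<open>mult\<close> and \<^const>\<open>one\<close> of a record used as a vector space are irrelevant.\<close>

definition quot_vs :: "('k, 'v, 'y) module_scheme \<Rightarrow> 'v set \<Rightarrow> ('k, 'v set) module" where
  "quot_vs V W = \<lparr>carrier = a_rcosets\<^bsub>V\<^esub> W,
     mult = (\<lambda>X Y. W), one = W, zero = W,
     add = set_add V,
     smult = (\<lambda>a X. \<Union>v\<in>X. W +>\<^bsub>V\<^esub> (a \<odot>\<^bsub>V\<^esub> v))\<rparr>"

definition tensor_relations ::
  "('k, 'x) ring_scheme \<Rightarrow> ('k, 'm, 'y) module_scheme \<Rightarrow> ('k, 'n, 'z) module_scheme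
    \<Rightarrow> ('m \<times> 'n \<Rightarrow> 'k) set" where
  "tensor_relations K M N =
    (let F = free_vs K (carrier M \<times> carrier N);
         g = (\<lambda>m n. free_gen K (carrier M \<times> carrier N) (m, n)) in
      {g (m \<oplus>\<^bsub>M\<^esub> m') n \<ominus>\<^bsub>F\<^esub> (g m n \<oplus>\<^bsub>F\<^esub> g m' n) | m m' n.
          m \<in> carrier M \<and> m' \<in> carrier M \<and> n \<in> carrier N}
    \<union> {g m (n \<oplus>\<^bsub>N\<^esub> n') \<ominus>\<^bsub>F\<^esub> (g m n \<oplus>\<^bsub>F\<^esub> g m n') | m n n'.
          m \<in> carrier M \<and> n \<in> carrier N \<and> n' \<in> carrier N}
    \<union> {g (a \<odot>\<^bsub>M\<^esub> m) n \<ominus>\<^bsub>F\<^esub> a \<odot>\<^bsub>F\<^esub> g m n | a m n.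
          a \<in> carrier K \<and> m \<in> carrier M \<and> n \<in> carrier N}
    \<union> {g m (a \<odot>\<^bsub>N\<^esub> n) \<ominus>\<^bsub>F\<^esub> a \<odot>\<^bsub>F\<^esub> g m n | a m n.
          a \<in> carrier K \<and> m \<in> carrier M \<and> n \<in> carrier N})"

definition tensor_kernel ::
  "('k, 'x) ring_scheme \<Rightarrow> ('k, 'm, 'y) module_scheme \<Rightarrow> ('k, 'n, 'z) module_scheme
    \<Rightarrow> ('m \<times> 'n \<Rightarrow> 'k) set" where
  "tensor_kernel K M N =
     module.span K (free_vs K (carrier M \<times> carrier N)) (tensor_relations K M N)"

type_synonym ('k, 'm, 'n) tensor = "('m \<times> 'n \<Rightarrow> 'k) set"

definition tensor ::
  "('k, 'x) ring_scheme \<Rightarrow> ('k, 'm, 'y) module_scheme \<Rightarrow> ('k, 'n, 'z) module_scheme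
    \<Rightarrow> ('k, ('k, 'm, 'n) tensor) module" where
  "tensor K M N = quot_vs (free_vs K (carrier M \<times> carrier N)) (tensor_kernel K M N)"

definition pure_tensor ::
  "('k, 'x) ring_scheme \<Rightarrow> ('k, 'm, 'y) module_scheme \<Rightarrow> ('k, 'n, 'z) module_scheme
    \<Rightarrow> 'm \<Rightarrow> 'n \<Rightarrow> ('k, 'm, 'n) tensor" where
  "pure_tensor K M N m n =
     tensor_kernel K M N +>\<^bsub>free_vs K (carrier M \<times> carrier N)\<^esub>
       free_gen K (carrier M \<times> carrier N) (m, n)"

definition bilinear_map ::
  "('k, 'x) ring_scheme \<Rightarrow> ('k, 'm, 'y) module_scheme \<Rightarrow> ('k, 'n, 'z) module_scheme
    \<Rightarrow> ('k, 'p, 'w) module_scheme \<Rightarrow> ('m \<Rightarrow> 'n \<Rightarrow> 'p) \<Rightarrow> bool" where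
  "bilinear_map K M N P f \<longleftrightarrow>
     (\<forall>m\<in>carrier M. f m \<in> module_hom K N P) \<and>
     (\<forall>n\<in>carrier N. (\<lambda>m. f m n) \<in> module_hom K M P)"

text \<open>The linear map on the tensor product induced by a bilinear map; see the theorem
  \<open>tensor_universal\<close> below for existence and uniqueness.\<close>

definition tensor_lift ::
  "('k, 'x) ring_scheme \<Rightarrow> ('k, 'm, 'y) module_scheme \<Rightarrow> ('k, 'n, 'z) module_scheme
    \<Rightarrow> ('k, 'p, 'w) module_scheme \<Rightarrow> ('m \<Rightarrow> 'n \<Rightarrow> 'p) \<Rightarrow> ('k, 'm, 'n) tensor \<Rightarrow> 'p" where
  "tensor_lift K M N P f =
     (THE h. h \<in> module_hom K (tensor K M N) P \<and> h \<in> extensional (carrier (tensor K M N)) \<and>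
        (\<forall>m\<in>carrier M. \<forall>n\<in>carrier N. h (pure_tensor K M N m n) = f m n))"


lemma free_vs_module:
  assumes "cring K"
  shows "module K (free_vs K S)"
proof -
  interpret cring K by fact
  interpret F: module K "func_space S" by (rule func_space_is_module)
  have "submodule K {f \<in> carrier (func_space S). finite {s \<in> S. f s \<noteq> \<zero>\<^bsub>K\<^esub>}} (func_space S)"
  proof (rule submodule.intro)
    show "module K (func_space S)" by (rule func_space_is_module)
    show "{f \<in> carrier (func_space S). finite {s \<in> S. f s \<noteq> \<zero>\<^bsub>K\<^esub>}} \<subseteq> carrier (func_space S)"
      by auto
    show "\<zero>\<^bsub>func_space S\<^esub> \<in> {f \<in> carrier (func_space S). finite {s \<in> S. f s \<noteq> \<zero>\<^bsub>K\<^esub>}}"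
      using F.M.zero_closed by (auto simp: func_space_def cong: conj_cong)
  next
    fix v w assume v: "v \<in> {f \<in> carrier (func_space S). finite {s \<in> S. f s \<noteq> \<zero>\<^bsub>K\<^esub>}}"
      and w: "w \<in> {f \<in> carrier (func_space S). finite {s \<in> S. f s \<noteq> \<zero>\<^bsub>K\<^esub>}}"
    have "{s \<in> S. (v \<oplus>\<^bsub>func_space S\<^esub> w) s \<noteq> \<zero>\<^bsub>K\<^esub>} \<subseteq>
        {s \<in> S. v s \<noteq> \<zero>\<^bsub>K\<^esub>} \<union> {s \<in> S. w s \<noteq> \<zero>\<^bsub>K\<^esub>}"
      by (auto simp: func_space_def)
    then have "finite {s \<in> S. (v \<oplus>\<^bsub>func_space S\<^esub> w) s \<noteq> \<zero>\<^bsub>K\<^esub>}"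
      by (rule finite_subset) (use v w in auto)
    then show "v \<oplus>\<^bsub>func_space S\<^esub> w \<in> {f \<in> carrier (func_space S). finite {s \<in> S. f s \<noteq> \<zero>\<^bsub>K\<^esub>}}"
      using v w by auto
  next
    fix c v assume c: "c \<in> carrier K"
      and v: "v \<in> {f \<in> carrier (func_space S). finite {s \<in> S. f s \<noteq> \<zero>\<^bsub>K\<^esub>}}"
    have "{s \<in> S. (c \<odot>\<^bsub>func_space S\<^esub> v) s \<noteq> \<zero>\<^bsub>K\<^esub>} \<subseteq> {s \<in> S. v s \<noteq> \<zero>\<^bsub>K\<^esub>}"
      using c by (auto simp: func_space_def)
    then have "finite {s \<in> S. (c \<odot>\<^bsub>func_space S\<^esub> v) s \<noteq> \<zero>\<^bsub>K\<^esub>}"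
      by (rule finite_subset) (use v in auto)
    then show "c \<odot>\<^bsub>func_space S\<^esub> v \<in> {f \<in> carrier (func_space S). finite {s \<in> S. f s \<noteq> \<zero>\<^bsub>K\<^esub>}}"
      using c v by auto
  qed
  from F.submodule_is_module[OF this] show ?thesis by (simp add: free_vs_def)
qed

lemma quot_vs_props:
  assumes "module K V" and "submodule K W V"
  shows quot_vs_module: "module K (quot_vs V W)"
    and quot_vs_proj: "a_r_coset V W \<in> module_hom K V (quot_vs V W)"
    and quot_vs_carrier: "carrier (quot_vs V W) = a_r_coset V W ` carrier V"
    and quot_vs_eq: "\<And>v w. \<lbrakk>v \<in> carrier V; w \<in> carrier V\<rbrakk> \<Longrightarrow>
      a_r_coset V W v = a_r_coset V W w \<longleftrightarrow> v \<ominus>\<^bsub>V\<^esub> w \<in> W"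
proof -
  interpret module K V by fact
  interpret W: submodule K W V by fact
  have neg: "\<ominus>\<^bsub>V\<^esub> w \<in> W" if "w \<in> W" for w
    using smult_minus_1[of w] W.smult_closed[OF R.a_inv_closed[OF R.one_closed] that] W.subset that
    by (metis subsetD)
  have sg: "additive_subgroup W V"
    by (rule additive_subgroup.intro, rule add.subgroupI)
      (use W.subset W.zero_closed neg W.m_closed in \<open>auto simp: a_inv_def simp del: W.zero_closed\<close>)
  interpret A: abelian_subgroup W V
    by (rule abelian_subgroupI3[OF sg]) (rule M.abelian_group_axioms)
  show eq: "a_r_coset V W v = a_r_coset V W w \<longleftrightarrow> v \<ominus>\<^bsub>V\<^esub> w \<in> W"
    if "v \<in> carrier V" "w \<in> carrier V" for v w
    using that A.a_rcos_module[of w v] A.a_repr_independence'[of v w] A.a_rcos_self[of v]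
    by (auto simp: a_minus_def)
  show car: "carrier (quot_vs V W) = a_r_coset V W ` carrier V"
    by (auto simp: quot_vs_def A_RCOSETS_def')
  have add: "(W +>\<^bsub>V\<^esub> v) \<oplus>\<^bsub>quot_vs V W\<^esub> (W +>\<^bsub>V\<^esub> w) = W +>\<^bsub>V\<^esub> (v \<oplus>\<^bsub>V\<^esub> w)"
    if "v \<in> carrier V" "w \<in> carrier V" for v w
    using that by (simp add: quot_vs_def A.a_rcos_sum)
  have smult: "a \<odot>\<^bsub>quot_vs V W\<^esub> (W +>\<^bsub>V\<^esub> v) = W +>\<^bsub>V\<^esub> (a \<odot>\<^bsub>V\<^esub> v)"
    if a: "a \<in> carrier K" and v: "v \<in> carrier V" for a v
  proof -
    have cong: "W +>\<^bsub>V\<^esub> (a \<odot>\<^bsub>V\<^esub> u) = W +>\<^bsub>V\<^esub> (a \<odot>\<^bsub>V\<^esub> v)" if u: "u \<in> W +>\<^bsub>V\<^esub> v" for u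
    proof -
      have uc: "u \<in> carrier V" using u v A.a_elemrcos_carrier by blast
      have "u \<ominus>\<^bsub>V\<^esub> v \<in> W" using A.a_rcos_module[OF v uc] u by (simp add: a_minus_def)
      then have "a \<odot>\<^bsub>V\<^esub> (u \<ominus>\<^bsub>V\<^esub> v) \<in> W" using a by simp
      then show ?thesis
        using a v uc by (subst eq) (auto simp: a_minus_def smult_r_distr smult_r_minus)
    qed
    have "(\<Union>u\<in>W +>\<^bsub>V\<^esub> v. W +>\<^bsub>V\<^esub> (a \<odot>\<^bsub>V\<^esub> u)) = (\<Union>u\<in>W +>\<^bsub>V\<^esub> v. W +>\<^bsub>V\<^esub> (a \<odot>\<^bsub>V\<^esub> v))"
      by (intro SUP_cong refl cong)
    also have "\<dots> = W +>\<^bsub>V\<^esub> (a \<odot>\<^bsub>V\<^esub> v)" using A.a_rcos_self[OF v] by blast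
    finally show ?thesis by (simp add: quot_vs_def)
  qed
  have zero: "\<zero>\<^bsub>quot_vs V W\<^esub> = W +>\<^bsub>V\<^esub> \<zero>\<^bsub>V\<^esub>"
    using W.subset by (simp add: quot_vs_def a_coset_add_zero)
  show "module K (quot_vs V W)"
  proof (rule module_criteria, goal_cases)
    case 1 show ?case by (rule R.is_cring)
  next
    case 2 show ?case by (auto simp: zero car)
  next
    case 3 show ?case by (auto simp: add car)
  next
    case 4
    show ?case
    proof
      fix X assume "X \<in> carrier (quot_vs V W)"
      then obtain v where v: "v \<in> carrier V" "X = W +>\<^bsub>V\<^esub> v" by (auto simp: car)
      then show "\<exists>Y\<in>carrier (quot_vs V W). X \<oplus>\<^bsub>quot_vs V W\<^esub> Y = \<zero>\<^bsub>quot_vs V W\<^esub>"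
        by (intro bexI[of _ "W +>\<^bsub>V\<^esub> (\<ominus>\<^bsub>V\<^esub> v)"]) (auto simp: car add zero M.r_neg)
    qed
  qed (auto simp: add car smult zero M.a_ac smult_assoc1 smult_l_distr smult_r_distr)
  show "a_r_coset V W \<in> module_hom K V (quot_vs V W)"
    by (auto simp: module_hom_def car add smult)
qed

lemma free_vs_simps:
  "\<zero>\<^bsub>free_vs K S\<^esub> = (\<lambda>s\<in>S. \<zero>\<^bsub>K\<^esub>)"
  "f \<oplus>\<^bsub>free_vs K S\<^esub> g = (\<lambda>s\<in>S. f s \<oplus>\<^bsub>K\<^esub> g s)"
  "a \<odot>\<^bsub>free_vs K S\<^esub> f = (\<lambda>s\<in>S. a \<otimes>\<^bsub>K\<^esub> f s)"
  if "cring K"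
  using that by (auto simp: free_vs_def ring.func_space_def cring_def)

lemma free_vs_carrier:
  "carrier (free_vs K S) = {f \<in> S \<rightarrow>\<^sub>E carrier K. finite {s \<in> S. f s \<noteq> \<zero>\<^bsub>K\<^esub>}}"
  if "cring K"
  using that by (auto simp: free_vs_def ring.func_space_def cring_def)

lemma free_gen_closed:
  assumes "cring K" "s \<in> S"
  shows "free_gen K S s \<in> carrier (free_vs K S)"
proof -
  interpret cring K by fact
  have "{t \<in> S. free_gen K S s t \<noteq> \<zero>\<^bsub>K\<^esub>} \<subseteq> {s}" by (auto simp: free_gen_def)
  then have "finite {t \<in> S. free_gen K S s t \<noteq> \<zero>\<^bsub>K\<^esub>}" using finite_subset by blast
  then show ?thesis using assms by (auto simp: free_vs_carrier free_gen_def)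
qed

lemma free_vs_induct:
  assumes "cring K" and f: "f \<in> carrier (free_vs K S)"
    and zero: "P \<zero>\<^bsub>free_vs K S\<^esub>"
    and step: "\<And>a s g. \<lbrakk>a \<in> carrier K; s \<in> S; g \<in> carrier (free_vs K S); P g\<rbrakk>
      \<Longrightarrow> P (a \<odot>\<^bsub>free_vs K S\<^esub> free_gen K S s \<oplus>\<^bsub>free_vs K S\<^esub> g)"
  shows "P f"
proof -
  interpret cring K by fact
  have "P f" if "finite A" "f \<in> carrier (free_vs K S)" "{s \<in> S. f s \<noteq> \<zero>\<^bsub>K\<^esub>} \<subseteq> A" for A f
    using that
  proof (induction A arbitrary: f rule: finite_induct)
    case empty
    then have "f = \<zero>\<^bsub>free_vs K S\<^esub>"
      by (auto simp: free_vs_simps[OF assms(1)] free_vs_carrier[OF assms(1)] fun_eq_iff PiE_def extensional_def)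
    then show ?case using zero by simp
  next
    case (insert x A)
    show ?case
    proof (cases "x \<in> S")
      case False
      then show ?thesis using insert by blast
    next
      case True
      define g where "g = f(x := \<zero>\<^bsub>K\<^esub>)"
      have sub: "{s \<in> S. g s \<noteq> \<zero>\<^bsub>K\<^esub>} \<subseteq> A" using insert.prems by (auto simp: g_def)
      have g: "g \<in> carrier (free_vs K S)"
        using insert.prems sub True finite_subset[OF sub insert.hyps(1)]
        by (auto simp: free_vs_carrier[OF assms(1)] g_def PiE_def extensional_def)
      have fc: "f s \<in> carrier K" if "s \<in> S" for s
        using insert.prems that by (auto simp: free_vs_carrier[OF assms(1)])
      have "f = f x \<odot>\<^bsub>free_vs K S\<^esub> free_gen K S x \<oplus>\<^bsub>free_vs K S\<^esub> g"
      proof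
        fix t
        show "f t = (f x \<odot>\<^bsub>free_vs K S\<^esub> free_gen K S x \<oplus>\<^bsub>free_vs K S\<^esub> g) t"
        proof (cases "t \<in> S")
          case False
          then show ?thesis using insert.prems
            by (auto simp: free_vs_simps[OF assms(1)] free_vs_carrier[OF assms(1)] PiE_def extensional_def)
        next
          case True
          then show ?thesis using fc[OF \<open>x \<in> S\<close>] fc[OF True]
            by (auto simp: free_vs_simps[OF assms(1)] free_gen_def g_def)
        qed
      qed
      moreover have "P (f x \<odot>\<^bsub>free_vs K S\<^esub> free_gen K S x \<oplus>\<^bsub>free_vs K S\<^esub> g)"
        by (rule step[OF fc[OF True] True g]) (rule insert.IH[OF g sub])
      ultimately show ?thesis by simp
    qed
  qed
  moreover have "finite {s \<in> S. f s \<noteq> \<zero>\<^bsub>K\<^esub>}" using f by (auto simp: free_vs_carrier[OF assms(1)])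
  ultimately show ?thesis using f by blast
qed

lemma free_vs_lift:
  assumes "module K P" and b: "b \<in> S \<rightarrow> carrier P"
  obtains h where "h \<in> module_hom K (free_vs K S) P" "\<And>s. s \<in> S \<Longrightarrow> h (free_gen K S s) = b s"
proof -
  interpret module K P by fact
  note simps = free_vs_simps[OF R.is_cring] free_vs_carrier[OF R.is_cring]
  define h where "h f = (\<Oplus>\<^bsub>P\<^esub>s\<in>{s \<in> S. f s \<noteq> \<zero>\<^bsub>K\<^esub>}. f s \<odot>\<^bsub>P\<^esub> b s)" for f
  have bc: "b s \<in> carrier P" if "s \<in> S" for s using b that by auto
  have fc: "f s \<in> carrier K" if "f \<in> carrier (free_vs K S)" "s \<in> S" for f s
    using that by (auto simp: simps)
  have sup: "h f = (\<Oplus>\<^bsub>P\<^esub>s\<in>A. f s \<odot>\<^bsub>P\<^esub> b s)"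
    if "f \<in> carrier (free_vs K S)" "finite A" "A \<subseteq> S" "{s \<in> S. f s \<noteq> \<zero>\<^bsub>K\<^esub>} \<subseteq> A" for f A
    unfolding h_def
    by (rule M.add.finprod_mono_neutral_cong_left)
      (use that bc fc[OF that(1)] in auto)
  have fin: "finite {s \<in> S. f s \<noteq> \<zero>\<^bsub>K\<^esub>}" if "f \<in> carrier (free_vs K S)" for f
    using that by (auto simp: simps)
  have closed: "h f \<in> carrier P" if "f \<in> carrier (free_vs K S)" for f
    unfolding h_def using bc fc[OF that] by (intro M.finsum_closed) auto
  interpret F: module K "free_vs K S" by (rule free_vs_module[OF R.is_cring])
  have "h \<in> module_hom K (free_vs K S) P"
    unfolding module_hom_def
  proof (intro CollectI conjI allI impI)
    show "h \<in> carrier (free_vs K S) \<rightarrow> carrier P" using closed by auto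
  next
    fix f g assume fg: "f \<in> carrier (free_vs K S) \<and> g \<in> carrier (free_vs K S)"
    let ?A = "{s \<in> S. f s \<noteq> \<zero>\<^bsub>K\<^esub>} \<union> {s \<in> S. g s \<noteq> \<zero>\<^bsub>K\<^esub>}"
    have A: "finite ?A" "?A \<subseteq> S" using fg fin by auto
    have "h (f \<oplus>\<^bsub>free_vs K S\<^esub> g) = (\<Oplus>\<^bsub>P\<^esub>s\<in>?A. (f \<oplus>\<^bsub>free_vs K S\<^esub> g) s \<odot>\<^bsub>P\<^esub> b s)"
      by (rule sup[OF F.M.a_closed]) (use fg A in \<open>auto simp: free_vs_simps[OF R.is_cring]\<close>)
    also have "\<dots> = (\<Oplus>\<^bsub>P\<^esub>s\<in>?A. f s \<odot>\<^bsub>P\<^esub> b s \<oplus>\<^bsub>P\<^esub> g s \<odot>\<^bsub>P\<^esub> b s)"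
      by (rule M.finsum_cong') (use fg fc bc in \<open>auto simp: free_vs_simps[OF R.is_cring] smult_l_distr\<close>)
    also have "\<dots> = (\<Oplus>\<^bsub>P\<^esub>s\<in>?A. f s \<odot>\<^bsub>P\<^esub> b s) \<oplus>\<^bsub>P\<^esub> (\<Oplus>\<^bsub>P\<^esub>s\<in>?A. g s \<odot>\<^bsub>P\<^esub> b s)"
      by (rule M.finsum_addf) (use fg fc bc in auto)
    also have "(\<Oplus>\<^bsub>P\<^esub>s\<in>?A. f s \<odot>\<^bsub>P\<^esub> b s) = h f" by (rule sup[symmetric]) (use fg A in auto)
    also have "(\<Oplus>\<^bsub>P\<^esub>s\<in>?A. g s \<odot>\<^bsub>P\<^esub> b s) = h g" by (rule sup[symmetric]) (use fg A in auto)
    finally show "h (f \<oplus>\<^bsub>free_vs K S\<^esub> g) = h f \<oplus>\<^bsub>P\<^esub> h g" .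
  next
    fix a f assume af: "a \<in> carrier K \<and> f \<in> carrier (free_vs K S)"
    let ?A = "{s \<in> S. f s \<noteq> \<zero>\<^bsub>K\<^esub>}"
    have A: "finite ?A" "?A \<subseteq> S" using af fin by auto
    have "h (a \<odot>\<^bsub>free_vs K S\<^esub> f) = (\<Oplus>\<^bsub>P\<^esub>s\<in>?A. (a \<odot>\<^bsub>free_vs K S\<^esub> f) s \<odot>\<^bsub>P\<^esub> b s)"
      by (rule sup[OF F.smult_closed]) (use af A in \<open>auto simp: free_vs_simps[OF R.is_cring]\<close>)
    also have "\<dots> = (\<Oplus>\<^bsub>P\<^esub>s\<in>?A. a \<odot>\<^bsub>P\<^esub> (f s \<odot>\<^bsub>P\<^esub> b s))"
      by (rule M.finsum_cong') (use af fc bc in \<open>auto simp: free_vs_simps[OF R.is_cring] smult_assoc1\<close>)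
    also have "\<dots> = a \<odot>\<^bsub>P\<^esub> h f"
      unfolding h_def by (rule finsum_smult[symmetric]) (use af A fc bc in auto)
    finally show "h (a \<odot>\<^bsub>free_vs K S\<^esub> f) = a \<odot>\<^bsub>P\<^esub> h f" .
  qed
  moreover have "h (free_gen K S s) = b s" if s: "s \<in> S" for s
  proof -
    have "h (free_gen K S s) = (\<Oplus>\<^bsub>P\<^esub>t\<in>{s}. free_gen K S s t \<odot>\<^bsub>P\<^esub> b t)"
      by (rule sup) (use s free_gen_closed[OF R.is_cring s] in \<open>auto simp: free_gen_def\<close>)
    also have "\<dots> = free_gen K S s s \<odot>\<^bsub>P\<^esub> b s"
      using s bc by (subst M.finsum_insert) (auto simp: free_gen_def)
    finally show ?thesis using s bc by (simp add: free_gen_def)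
  qed
  ultimately show ?thesis using that by blast
qed


lemma tensor_relations_subset:
  assumes "module K M" "module K N"
  shows "tensor_relations K M N \<subseteq> carrier (free_vs K (carrier M \<times> carrier N))"
proof -
  interpret M: module K M by fact
  interpret N: module K N by fact
  interpret F: module K "free_vs K (carrier M \<times> carrier N)"
    by (rule free_vs_module[OF M.R.is_cring])
  have g: "free_gen K (carrier M \<times> carrier N) (m, n) \<in> carrier (free_vs K (carrier M \<times> carrier N))"
    if "m \<in> carrier M" "n \<in> carrier N" for m n
    using that by (intro free_gen_closed[OF M.R.is_cring]) auto
  show ?thesis
    unfolding tensor_relations_def Let_def
    by (auto intro!: F.M.minus_closed F.M.a_closed F.smult_closed g)
qed

lemma tensor_kernel_submodule:
  assumes "module K M" "module K N"
  shows "submodule K (tensor_kernel K M N) (free_vs K (carrier M \<times> carrier N))"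
proof -
  interpret M: module K M by fact
  interpret F: module K "free_vs K (carrier M \<times> carrier N)"
    by (rule free_vs_module[OF M.R.is_cring])
  show ?thesis
    unfolding tensor_kernel_def
    by (rule F.span_is_submodule[OF tensor_relations_subset[OF assms]])
qed

theorem tensor_module:
  assumes "module K M" "module K N"
  shows "module K (tensor K M N)"
proof -
  interpret M: module K M by fact
  show ?thesis
    unfolding tensor_def
    by (rule quot_vs_module[OF free_vs_module[OF M.R.is_cring] tensor_kernel_submodule[OF assms]])
qed

theorem tensor_vectorspace:
  assumes "vectorspace K M" "vectorspace K N"
  shows "vectorspace K (tensor K M N)"
  using assms tensor_module[of K M N] by (auto simp: vectorspace_def)

theorem pure_tensor_bilinear:
  assumes "module K M" "module K N"
  shows "bilinear_map K M N (tensor K M N) (pure_tensor K M N)"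
proof -
  interpret M: module K M by fact
  interpret N: module K N by fact
  let ?F = "free_vs K (carrier M \<times> carrier N)" and ?W = "tensor_kernel K M N"
  let ?g = "\<lambda>m n. free_gen K (carrier M \<times> carrier N) (m, n)"
  interpret F: module K ?F by (rule free_vs_module[OF M.R.is_cring])
  note sub = tensor_kernel_submodule[OF assms]
  note q = quot_vs_props[OF F.module_axioms sub]
  have g: "?g m n \<in> carrier ?F" if "m \<in> carrier M" "n \<in> carrier N" for m n
    using that by (intro free_gen_closed[OF M.R.is_cring]) auto
  have rel: "r \<in> ?W" if "r \<in> tensor_relations K M N" for r
    unfolding tensor_kernel_def
    using that F.in_own_span[OF tensor_relations_subset[OF assms]] by auto
  have coset: "?W +>\<^bsub>?F\<^esub> u = ?W +>\<^bsub>?F\<^esub> v"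
    if "u \<ominus>\<^bsub>?F\<^esub> v \<in> tensor_relations K M N" "u \<in> carrier ?F" "v \<in> carrier ?F" for u v
    using q(4)[of u v] rel that by blast
  interpret T: module K "quot_vs ?F ?W" by (rule q(1))
  interpret p: mod_hom K ?F "quot_vs ?F ?W" "a_r_coset ?F ?W"
    by unfold_locales (rule q(2))
  have 1: "?W +>\<^bsub>?F\<^esub> ?g (m \<oplus>\<^bsub>M\<^esub> m') n = ?W +>\<^bsub>?F\<^esub> (?g m n \<oplus>\<^bsub>?F\<^esub> ?g m' n)"
    if "m \<in> carrier M" "m' \<in> carrier M" "n \<in> carrier N" for m m' n
  proof (rule coset)
    show "?g (m \<oplus>\<^bsub>M\<^esub> m') n \<ominus>\<^bsub>?F\<^esub> (?g m n \<oplus>\<^bsub>?F\<^esub> ?g m' n) \<in> tensor_relations K M N"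
      using that unfolding tensor_relations_def Let_def by blast
  qed (use that in \<open>auto intro!: g F.M.a_closed\<close>)
  have 2: "?W +>\<^bsub>?F\<^esub> ?g m (n \<oplus>\<^bsub>N\<^esub> n') = ?W +>\<^bsub>?F\<^esub> (?g m n \<oplus>\<^bsub>?F\<^esub> ?g m n')"
    if "m \<in> carrier M" "n \<in> carrier N" "n' \<in> carrier N" for m n n'
  proof (rule coset)
    show "?g m (n \<oplus>\<^bsub>N\<^esub> n') \<ominus>\<^bsub>?F\<^esub> (?g m n \<oplus>\<^bsub>?F\<^esub> ?g m n') \<in> tensor_relations K M N"
      using that unfolding tensor_relations_def Let_def by blast
  qed (use that in \<open>auto intro!: g F.M.a_closed\<close>)
  have 3: "?W +>\<^bsub>?F\<^esub> ?g (a \<odot>\<^bsub>M\<^esub> m) n = ?W +>\<^bsub>?F\<^esub> (a \<odot>\<^bsub>?F\<^esub> ?g m n)"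
    if "a \<in> carrier K" "m \<in> carrier M" "n \<in> carrier N" for a m n
  proof (rule coset)
    show "?g (a \<odot>\<^bsub>M\<^esub> m) n \<ominus>\<^bsub>?F\<^esub> a \<odot>\<^bsub>?F\<^esub> ?g m n \<in> tensor_relations K M N"
      using that unfolding tensor_relations_def Let_def by blast
  qed (use that in \<open>auto intro!: g F.smult_closed\<close>)
  have 4: "?W +>\<^bsub>?F\<^esub> ?g m (a \<odot>\<^bsub>N\<^esub> n) = ?W +>\<^bsub>?F\<^esub> (a \<odot>\<^bsub>?F\<^esub> ?g m n)"
    if "a \<in> carrier K" "m \<in> carrier M" "n \<in> carrier N" for a m n
  proof (rule coset)
    show "?g m (a \<odot>\<^bsub>N\<^esub> n) \<ominus>\<^bsub>?F\<^esub> a \<odot>\<^bsub>?F\<^esub> ?g m n \<in> tensor_relations K M N"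
      using that unfolding tensor_relations_def Let_def by blast
  qed (use that in \<open>auto intro!: g F.smult_closed\<close>)
  show ?thesis
    unfolding bilinear_map_def module_hom_def tensor_def pure_tensor_def
    by (auto simp: 1 2 3 4 g)
qed

lemma tensor_hom_eqI:
  assumes "module K M" "module K N" "module K P"
    and h: "h \<in> module_hom K (tensor K M N) P" and h': "h' \<in> module_hom K (tensor K M N) P"
    and eq: "\<And>m n. \<lbrakk>m \<in> carrier M; n \<in> carrier N\<rbrakk> \<Longrightarrow>
      h (pure_tensor K M N m n) = h' (pure_tensor K M N m n)"
    and X: "X \<in> carrier (tensor K M N)"
  shows "h X = h' X"
proof -
  interpret M: module K M by fact
  interpret P: module K P by fact
  let ?F = "free_vs K (carrier M \<times> carrier N)" and ?W = "tensor_kernel K M N"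
  interpret F: module K ?F by (rule free_vs_module[OF M.R.is_cring])
  note q = quot_vs_props[OF F.module_axioms tensor_kernel_submodule[OF assms(1,2)], folded tensor_def]
  interpret T: module K "tensor K M N" by (rule q(1))
  interpret p: mod_hom K ?F "tensor K M N" "a_r_coset ?F ?W"
    by unfold_locales (rule q(2))
  interpret h: mod_hom K "tensor K M N" P h by unfold_locales (rule h)
  interpret h': mod_hom K "tensor K M N" P h' by unfold_locales (rule h')
  obtain u where u: "u \<in> carrier ?F" "X = ?W +>\<^bsub>?F\<^esub> u" using X q(3) by auto
  have "h (?W +>\<^bsub>?F\<^esub> u) = h' (?W +>\<^bsub>?F\<^esub> u)"
    using u(1)
  proof (induction u rule: free_vs_induct[OF M.R.is_cring, consumes 1])
    case 1
    then show ?case by (simp add: p.f0_is_0)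
  next
    case (2 a s g)
    then obtain m n where s: "s = (m, n)" "m \<in> carrier M" "n \<in> carrier N" by auto
    have "free_gen K (carrier M \<times> carrier N) s \<in> carrier ?F"
      using 2 by (intro free_gen_closed[OF M.R.is_cring]) auto
    then show ?case using 2 s eq[of m n] by (simp add: pure_tensor_def)
  qed
  then show ?thesis using u by simp
qed

theorem tensor_universal:
  assumes "module K M" "module K N" "module K P" and f: "bilinear_map K M N P f"
  shows "\<exists>!h. h \<in> module_hom K (tensor K M N) P \<and> h \<in> extensional (carrier (tensor K M N)) \<and>
    (\<forall>m\<in>carrier M. \<forall>n\<in>carrier N. h (pure_tensor K M N m n) = f m n)"
proof -
  interpret M: module K M by fact
  interpret N: module K N by fact
  interpret P: module K P by fact
  let ?S = "carrier M \<times> carrier N"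
  let ?F = "free_vs K ?S" and ?W = "tensor_kernel K M N"
  interpret F: module K ?F by (rule free_vs_module[OF M.R.is_cring])
  note q = quot_vs_props[OF F.module_axioms tensor_kernel_submodule[OF assms(1,2)], folded tensor_def]
  interpret T: module K "tensor K M N" by (rule q(1))
  interpret p: mod_hom K ?F "tensor K M N" "a_r_coset ?F ?W"
    by unfold_locales (rule q(2))
  have fc: "f m n \<in> carrier P" if "m \<in> carrier M" "n \<in> carrier N" for m n
    using f that unfolding bilinear_map_def module_hom_def by auto
  obtain k where k: "k \<in> module_hom K ?F P"
    and kg: "\<And>s. s \<in> ?S \<Longrightarrow> k (free_gen K ?S s) = (\<lambda>(m, n). f m n) s"
    by (rule free_vs_lift[OF assms(3), of "\<lambda>(m, n). f m n" ?S]) (use fc in auto)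
  interpret k: mod_hom K ?F P k by unfold_locales (rule k)
  have g: "free_gen K ?S (m, n) \<in> carrier ?F" if "m \<in> carrier M" "n \<in> carrier N" for m n
    using that by (intro free_gen_closed[OF M.R.is_cring]) auto
  have kg': "k (free_gen K ?S (m, n)) = f m n" if "m \<in> carrier M" "n \<in> carrier N" for m n
    using kg[of "(m, n)"] that by auto
  have fadd1: "f (m \<oplus>\<^bsub>M\<^esub> m') n = f m n \<oplus>\<^bsub>P\<^esub> f m' n"
    if "m \<in> carrier M" "m' \<in> carrier M" "n \<in> carrier N" for m m' n
    using f that unfolding bilinear_map_def module_hom_def by auto
  have fadd2: "f m (n \<oplus>\<^bsub>N\<^esub> n') = f m n \<oplus>\<^bsub>P\<^esub> f m n'"
    if "m \<in> carrier M" "n \<in> carrier N" "n' \<in> carrier N" for m n n'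
    using f that unfolding bilinear_map_def module_hom_def by auto
  have fsm: "f (a \<odot>\<^bsub>M\<^esub> m) n = a \<odot>\<^bsub>P\<^esub> f m n" "f m (a \<odot>\<^bsub>N\<^esub> n) = a \<odot>\<^bsub>P\<^esub> f m n"
    if "a \<in> carrier K" "m \<in> carrier M" "n \<in> carrier N" for a m n
    using f that unfolding bilinear_map_def module_hom_def by auto
  have z: "x \<ominus>\<^bsub>P\<^esub> x = \<zero>\<^bsub>P\<^esub>" if "x \<in> carrier P" for x
    using that by (simp add: a_minus_def P.M.r_neg)
  have "tensor_relations K M N \<subseteq> k.ker"
    unfolding tensor_relations_def Let_def
    by (auto simp: k.ker_def g kg' fadd1 fadd2 fsm z fc)
  then have ker: "?W \<subseteq> k.ker"
    unfolding tensor_kernel_def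
    by (intro F.span_is_subset k.ker_is_submodule)
  define h where "h = (\<lambda>X\<in>carrier (tensor K M N). k (SOME u. u \<in> carrier ?F \<and> X = ?W +>\<^bsub>?F\<^esub> u))"
  have hk: "h (?W +>\<^bsub>?F\<^esub> u) = k u" if u: "u \<in> carrier ?F" for u
  proof -
    define v where "v = (SOME v. v \<in> carrier ?F \<and> ?W +>\<^bsub>?F\<^esub> u = ?W +>\<^bsub>?F\<^esub> v)"
    have v: "v \<in> carrier ?F \<and> ?W +>\<^bsub>?F\<^esub> u = ?W +>\<^bsub>?F\<^esub> v"
      unfolding v_def by (rule someI[of _ u]) (use u in auto)
    then have "u \<ominus>\<^bsub>?F\<^esub> v \<in> k.ker" using q(4)[of u v] u ker by auto
    then have "k u \<ominus>\<^bsub>P\<^esub> k v = \<zero>\<^bsub>P\<^esub>" using u v by (auto simp: k.ker_def)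
    then have "k u = k v" using u v
      by (metis P.M.add.inv_closed P.M.a_assoc P.M.l_neg P.M.l_zero P.M.r_zero a_minus_def k.f_im)
    then show ?thesis using u q(3) by (simp add: h_def v_def)
  qed
  have "h \<in> module_hom K (tensor K M N) P"
    unfolding module_hom_def
  proof (intro CollectI conjI allI impI funcsetI)
    fix X assume "X \<in> carrier (tensor K M N)"
    then show "h X \<in> carrier P" using q(3) hk by auto
  next
    fix X Y assume "X \<in> carrier (tensor K M N) \<and> Y \<in> carrier (tensor K M N)"
    then obtain u v where "u \<in> carrier ?F" "v \<in> carrier ?F"
      "X = ?W +>\<^bsub>?F\<^esub> u" "Y = ?W +>\<^bsub>?F\<^esub> v" using q(3) by auto
    then show "h (X \<oplus>\<^bsub>tensor K M N\<^esub> Y) = h X \<oplus>\<^bsub>P\<^esub> h Y"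
      by (simp add: hk flip: p.f_add)
  next
    fix a X assume "a \<in> carrier K \<and> X \<in> carrier (tensor K M N)"
    then obtain u where "a \<in> carrier K" "u \<in> carrier ?F"
      "X = ?W +>\<^bsub>?F\<^esub> u" using q(3) by auto
    then show "h (a \<odot>\<^bsub>tensor K M N\<^esub> X) = a \<odot>\<^bsub>P\<^esub> h X"
      by (simp add: hk flip: p.f_smult)
  qed
  moreover have "h \<in> extensional (carrier (tensor K M N))" by (simp add: h_def)
  moreover have "\<forall>m\<in>carrier M. \<forall>n\<in>carrier N. h (pure_tensor K M N m n) = f m n"
    by (simp add: pure_tensor_def hk g kg')
  ultimately show ?thesis
  proof (intro ex1I[of _ h] conjI, goal_cases)
    case (4 h')
    show ?case
    proof (rule extensionalityI[of _ "carrier (tensor K M N)"])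
      fix X assume "X \<in> carrier (tensor K M N)"
      then show "h' X = h X"
        using 4 by (intro tensor_hom_eqI[OF assms(1-3), of h' h X]) auto
    qed (use 4 in auto)
  qed auto
qed

lemma tensor_lift:
  assumes "module K M" "module K N" "module K P" and f: "bilinear_map K M N P f"
  shows "tensor_lift K M N P f \<in> module_hom K (tensor K M N) P"
    and "\<And>m n. \<lbrakk>m \<in> carrier M; n \<in> carrier N\<rbrakk> \<Longrightarrow>
      tensor_lift K M N P f (pure_tensor K M N m n) = f m n"
  using theI'[OF tensor_universal[OF assms]] unfolding tensor_lift_def by auto


section \<open>Maps between tensor products\<close>

definition tensor_map ::
  "('k, 'x) ring_scheme \<Rightarrow> ('k, 'm, 'y) module_scheme \<Rightarrow> ('k, 'n, 'z) module_scheme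
    \<Rightarrow> ('k, 'p, 'v) module_scheme \<Rightarrow> ('k, 'q, 'w) module_scheme \<Rightarrow> ('m \<Rightarrow> 'p) \<Rightarrow> ('n \<Rightarrow> 'q)
    \<Rightarrow> ('k, 'm, 'n) tensor \<Rightarrow> ('k, 'p, 'q) tensor" where
  "tensor_map K M N P Q f g =
     tensor_lift K M N (tensor K P Q) (\<lambda>m n. pure_tensor K P Q (f m) (g n))"

definition tensor_flip ::
  "('k, 'x) ring_scheme \<Rightarrow> ('k, 'm, 'y) module_scheme \<Rightarrow> ('k, 'n, 'z) module_scheme
    \<Rightarrow> ('k, 'm, 'n) tensor \<Rightarrow> ('k, 'n, 'm) tensor" where
  "tensor_flip K M N = tensor_lift K M N (tensor K N M) (\<lambda>m n. pure_tensor K N M n m)"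

text \<open>The canonical isomorphisms between \<open>(M \<otimes> N) \<otimes> P\<close> and \<open>M \<otimes> (N \<otimes> P)\<close>.\<close>

definition tensor_assoc ::
  "('k, 'x) ring_scheme \<Rightarrow> ('k, 'm, 'y) module_scheme \<Rightarrow> ('k, 'n, 'z) module_scheme
    \<Rightarrow> ('k, 'p, 'w) module_scheme
    \<Rightarrow> ('k, ('k, 'm, 'n) tensor, 'p) tensor \<Rightarrow> ('k, 'm, ('k, 'n, 'p) tensor) tensor" where
  "tensor_assoc K M N P =
     (let T = tensor K M (tensor K N P) in
      tensor_lift K (tensor K M N) P T
        (\<lambda>X p. tensor_lift K M N T
          (\<lambda>m n. pure_tensor K M (tensor K N P) m (pure_tensor K N P n p)) X))"

definition tensor_unassoc ::
  "('k, 'x) ring_scheme \<Rightarrow> ('k, 'm, 'y) module_scheme \<Rightarrow> ('k, 'n, 'z) module_scheme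
    \<Rightarrow> ('k, 'p, 'w) module_scheme
    \<Rightarrow> ('k, 'm, ('k, 'n, 'p) tensor) tensor \<Rightarrow> ('k, ('k, 'm, 'n) tensor, 'p) tensor" where
  "tensor_unassoc K M N P =
     (let T = tensor K (tensor K M N) P in
      tensor_lift K M (tensor K N P) T
        (\<lambda>m Y. tensor_lift K N P T
          (\<lambda>n p. pure_tensor K (tensor K M N) P (pure_tensor K M N m n) p) Y))"

text \<open>The map \<open>id\<^sub>M \<otimes> f \<otimes> id\<^sub>P : (M \<otimes> N) \<otimes> (N' \<otimes> P) \<rightarrow> (M \<otimes> Q) \<otimes> (Q' \<otimes> P)\<close>
  for \<open>f : N \<otimes> N' \<rightarrow> Q \<otimes> Q'\<close>.\<close>

definition tensor_middle ::
  "('k, 'x) ring_scheme \<Rightarrow> ('k, 'm, 'x1) module_scheme \<Rightarrow> ('k, 'n, 'x2) module_scheme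
    \<Rightarrow> ('k, 'n', 'x3) module_scheme \<Rightarrow> ('k, 'p, 'x4) module_scheme
    \<Rightarrow> ('k, 'q, 'x5) module_scheme \<Rightarrow> ('k, 'q', 'x6) module_scheme
    \<Rightarrow> (('k, 'n, 'n') tensor \<Rightarrow> ('k, 'q, 'q') tensor)
    \<Rightarrow> ('k, ('k, 'm, 'n) tensor, ('k, 'n', 'p) tensor) tensor
    \<Rightarrow> ('k, ('k, 'm, 'q) tensor, ('k, 'q', 'p) tensor) tensor" where
  "tensor_middle K M N N' P Q Q' f =
     tensor_unassoc K M Q (tensor K Q' P)
     \<circ> tensor_map K M (tensor K N (tensor K N' P)) M (tensor K Q (tensor K Q' P)) id
         (tensor_assoc K Q Q' P
          \<circ> tensor_map K (tensor K N N') P (tensor K Q Q') P f id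
          \<circ> tensor_unassoc K N N' P)
     \<circ> tensor_assoc K M N (tensor K N' P)"

definition ground_vs :: "('k, 'x) ring_scheme \<Rightarrow> ('k, 'k) module" where
  "ground_vs K = \<lparr>carrier = carrier K, mult = mult K, one = \<one>\<^bsub>K\<^esub>, zero = \<zero>\<^bsub>K\<^esub>,
     add = add K, smult = mult K\<rparr>"

text \<open>The maps \<open>\<alpha> \<otimes> \<beta> : M \<otimes> N \<rightarrow> K\<close>, \<open>\<alpha> \<otimes> id : M \<otimes> N \<rightarrow> N\<close> and \<open>id \<otimes> \<beta> : M \<otimes> N \<rightarrow> M\<close> for
  functionals \<open>\<alpha>\<close> and \<open>\<beta>\<close>, with \<open>K \<otimes> K\<close>, \<open>K \<otimes> N\<close> and \<open>M \<otimes> K\<close> identified with \<open>K\<close>, \<open>N\<close> and \<open>M\<close>.\<close>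

definition tensor_functional ::
  "('k, 'x) ring_scheme \<Rightarrow> ('k, 'm, 'y) module_scheme \<Rightarrow> ('k, 'n, 'z) module_scheme
    \<Rightarrow> ('m \<Rightarrow> 'k) \<Rightarrow> ('n \<Rightarrow> 'k) \<Rightarrow> ('k, 'm, 'n) tensor \<Rightarrow> 'k" where
  "tensor_functional K M N \<alpha> \<beta> = tensor_lift K M N (ground_vs K) (\<lambda>m n. \<alpha> m \<otimes>\<^bsub>K\<^esub> \<beta> n)"

definition contract_left ::
  "('k, 'x) ring_scheme \<Rightarrow> ('k, 'm, 'y) module_scheme \<Rightarrow> ('k, 'n, 'z) module_scheme
    \<Rightarrow> ('m \<Rightarrow> 'k) \<Rightarrow> ('k, 'm, 'n) tensor \<Rightarrow> 'n" where
  "contract_left K M N \<alpha> = tensor_lift K M N N (\<lambda>m n. \<alpha> m \<odot>\<^bsub>N\<^esub> n)"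

definition contract_right ::
  "('k, 'x) ring_scheme \<Rightarrow> ('k, 'm, 'y) module_scheme \<Rightarrow> ('k, 'n, 'z) module_scheme
    \<Rightarrow> ('n \<Rightarrow> 'k) \<Rightarrow> ('k, 'm, 'n) tensor \<Rightarrow> 'm" where
  "contract_right K M N \<beta> = tensor_lift K M N M (\<lambda>m n. \<beta> n \<odot>\<^bsub>M\<^esub> m)"


lemma bilinear_mapI:
  assumes "\<And>m. m \<in> carrier M \<Longrightarrow> f m \<in> module_hom K N P"
    and "\<And>n. n \<in> carrier N \<Longrightarrow> (\<lambda>m. f m n) \<in> module_hom K M P"
  shows "bilinear_map K M N P f"
  using assms by (simp add: bilinear_map_def)

lemma module_hom_comp:
  assumes "f \<in> module_hom K M N" "g \<in> module_hom K N P"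
  shows "(\<lambda>x. g (f x)) \<in> module_hom K M P"
  using assms by (auto simp: module_hom_def Pi_iff)

lemma module_hom_id: "id \<in> module_hom K M M"
  by (auto simp: module_hom_def)

lemma pure_tensor_hom:
  assumes "module K M" "module K N"
  shows "m \<in> carrier M \<Longrightarrow> pure_tensor K M N m \<in> module_hom K N (tensor K M N)"
    and "n \<in> carrier N \<Longrightarrow> (\<lambda>m. pure_tensor K M N m n) \<in> module_hom K M (tensor K M N)"
  using pure_tensor_bilinear[OF assms] by (auto simp: bilinear_map_def)

lemma pure_tensor_closed:
  assumes "module K M" "module K N" "m \<in> carrier M" "n \<in> carrier N"
  shows "pure_tensor K M N m n \<in> carrier (tensor K M N)"
  using module_hom_closed[OF pure_tensor_hom(1)[OF assms(1-3)]] assms(4) by auto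

lemma tensor_map:
  assumes "module K M" "module K N" "module K P" "module K Q"
    and f: "f \<in> module_hom K M P" and g: "g \<in> module_hom K N Q"
  shows "tensor_map K M N P Q f g \<in> module_hom K (tensor K M N) (tensor K P Q)"
    and "\<And>m n. \<lbrakk>m \<in> carrier M; n \<in> carrier N\<rbrakk> \<Longrightarrow>
      tensor_map K M N P Q f g (pure_tensor K M N m n) = pure_tensor K P Q (f m) (g n)"
proof -
  have "bilinear_map K M N (tensor K P Q) (\<lambda>m n. pure_tensor K P Q (f m) (g n))"
    using module_hom_closed[OF f] module_hom_closed[OF g]
    by (intro bilinear_mapI module_hom_comp[OF f pure_tensor_hom(2)[OF assms(3,4)]]
        module_hom_comp[OF g pure_tensor_hom(1)[OF assms(3,4)]]) auto
  note l = tensor_lift[OF assms(1,2) tensor_module[OF assms(3,4)] this]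
  show "tensor_map K M N P Q f g \<in> module_hom K (tensor K M N) (tensor K P Q)"
    and "\<And>m n. \<lbrakk>m \<in> carrier M; n \<in> carrier N\<rbrakk> \<Longrightarrow>
      tensor_map K M N P Q f g (pure_tensor K M N m n) = pure_tensor K P Q (f m) (g n)"
    using l by (auto simp: tensor_map_def)
qed

lemma tensor_flip:
  assumes "module K M" "module K N"
  shows "tensor_flip K M N \<in> module_hom K (tensor K M N) (tensor K N M)"
    and "\<And>m n. \<lbrakk>m \<in> carrier M; n \<in> carrier N\<rbrakk> \<Longrightarrow>
      tensor_flip K M N (pure_tensor K M N m n) = pure_tensor K N M n m"
proof -
  have "bilinear_map K M N (tensor K N M) (\<lambda>m n. pure_tensor K N M n m)"
    by (intro bilinear_mapI pure_tensor_hom[OF assms(2,1)])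
  note l = tensor_lift[OF assms tensor_module[OF assms(2,1)] this]
  show "tensor_flip K M N \<in> module_hom K (tensor K M N) (tensor K N M)"
    and "\<And>m n. \<lbrakk>m \<in> carrier M; n \<in> carrier N\<rbrakk> \<Longrightarrow>
      tensor_flip K M N (pure_tensor K M N m n) = pure_tensor K N M n m"
    using l by (auto simp: tensor_flip_def)
qed

lemma module_hom_addI:
  assumes "module K P" "f \<in> module_hom K M P" "g \<in> module_hom K M P"
  shows "(\<lambda>x. f x \<oplus>\<^bsub>P\<^esub> g x) \<in> module_hom K M P"
proof -
  interpret module K P by fact
  show ?thesis using assms(2,3)
    by (auto simp: module_hom_def Pi_iff smult_r_distr M.a_ac)
qed

lemma module_hom_smultI:
  assumes "module K P" "f \<in> module_hom K M P" "a \<in> carrier K"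
  shows "(\<lambda>x. a \<odot>\<^bsub>P\<^esub> f x) \<in> module_hom K M P"
proof -
  interpret module K P by fact
  have "a \<odot>\<^bsub>P\<^esub> (r \<odot>\<^bsub>P\<^esub> y) = r \<odot>\<^bsub>P\<^esub> (a \<odot>\<^bsub>P\<^esub> y)"
    if "r \<in> carrier K" "y \<in> carrier P" for r y
    using that assms(3) by (simp add: R.m_comm flip: smult_assoc1)
  then show ?thesis using assms(2,3)
    by (auto simp: module_hom_def Pi_iff smult_r_distr)
qed

lemma tensor_lift_param:
  assumes M: "module K M" and N: "module K N" and Q: "module K Q"
    and F: "\<And>p. p \<in> carrier P \<Longrightarrow> bilinear_map K M N Q (F p)"
    and lin: "\<And>m n. \<lbrakk>m \<in> carrier M; n \<in> carrier N\<rbrakk> \<Longrightarrow> (\<lambda>p. F p m n) \<in> module_hom K P Q"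
    and P: "module K P" and X: "X \<in> carrier (tensor K M N)"
  shows "(\<lambda>p. tensor_lift K M N Q (F p) X) \<in> module_hom K P Q"
proof -
  interpret P: module K P by fact
  note l = tensor_lift[OF M N Q F]
  have "tensor_lift K M N Q (F p) X \<in> carrier Q" if "p \<in> carrier P" for p
    using module_hom_closed[OF l(1)[OF that]] X by auto
  moreover have "tensor_lift K M N Q (F (p \<oplus>\<^bsub>P\<^esub> p')) X =
      tensor_lift K M N Q (F p) X \<oplus>\<^bsub>Q\<^esub> tensor_lift K M N Q (F p') X"
    if p: "p \<in> carrier P" "p' \<in> carrier P" for p p'
    by (rule tensor_hom_eqI[OF M N Q l(1) module_hom_addI[OF Q l(1) l(1)] _ X])
      (use p l(2) module_hom_add[OF lin] in auto)
  moreover have "tensor_lift K M N Q (F (a \<odot>\<^bsub>P\<^esub> p)) X = a \<odot>\<^bsub>Q\<^esub> tensor_lift K M N Q (F p) X"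
    if p: "a \<in> carrier K" "p \<in> carrier P" for a p
    by (rule tensor_hom_eqI[OF M N Q l(1) module_hom_smultI[OF Q l(1)] _ X])
      (use p l(2) module_hom_smult[OF lin] in auto)
  ultimately show ?thesis by (auto simp: module_hom_def)
qed

lemma tensor_assoc:
  assumes M: "module K M" and N: "module K N" and P: "module K P"
  shows "tensor_assoc K M N P \<in>
      module_hom K (tensor K (tensor K M N) P) (tensor K M (tensor K N P))"
    and "\<And>m n p. \<lbrakk>m \<in> carrier M; n \<in> carrier N; p \<in> carrier P\<rbrakk> \<Longrightarrow>
      tensor_assoc K M N P (pure_tensor K (tensor K M N) P (pure_tensor K M N m n) p) =
      pure_tensor K M (tensor K N P) m (pure_tensor K N P n p)"
proof -
  let ?T = "tensor K M (tensor K N P)"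
  let ?F = "\<lambda>p m n. pure_tensor K M (tensor K N P) m (pure_tensor K N P n p)"
  note NP = tensor_module[OF N P] and MN = tensor_module[OF M N]
  note T = tensor_module[OF M NP]
  note c = pure_tensor_closed[OF N P]
  have F: "bilinear_map K M N ?T (?F p)" if "p \<in> carrier P" for p
    by (intro bilinear_mapI module_hom_comp[OF pure_tensor_hom(2)[OF N P that]]
        pure_tensor_hom[OF M NP] c that)
  have lin: "(\<lambda>p. ?F p m n) \<in> module_hom K P ?T" if "m \<in> carrier M" "n \<in> carrier N" for m n
    by (intro module_hom_comp[OF pure_tensor_hom(1)[OF N P]] pure_tensor_hom[OF M NP] that)
  have "bilinear_map K (tensor K M N) P ?T (\<lambda>X p. tensor_lift K M N ?T (?F p) X)"
    by (intro bilinear_mapI tensor_lift_param[OF M N T F lin P] tensor_lift(1)[OF M N T F])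
  note l = tensor_lift[OF MN P T this]
  show "tensor_assoc K M N P \<in> module_hom K (tensor K (tensor K M N) P) ?T"
    using l(1) by (simp add: tensor_assoc_def Let_def)
  show "tensor_assoc K M N P (pure_tensor K (tensor K M N) P (pure_tensor K M N m n) p) =
      pure_tensor K M (tensor K N P) m (pure_tensor K N P n p)"
    if "m \<in> carrier M" "n \<in> carrier N" "p \<in> carrier P" for m n p
    using l(2)[OF pure_tensor_closed[OF M N that(1,2)] that(3)] tensor_lift(2)[OF M N T F[OF that(3)] that(1,2)]
    by (simp add: tensor_assoc_def Let_def)
qed

lemma tensor_unassoc:
  assumes M: "module K M" and N: "module K N" and P: "module K P"
  shows "tensor_unassoc K M N P \<in>
      module_hom K (tensor K M (tensor K N P)) (tensor K (tensor K M N) P)"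
    and "\<And>m n p. \<lbrakk>m \<in> carrier M; n \<in> carrier N; p \<in> carrier P\<rbrakk> \<Longrightarrow>
      tensor_unassoc K M N P (pure_tensor K M (tensor K N P) m (pure_tensor K N P n p)) =
      pure_tensor K (tensor K M N) P (pure_tensor K M N m n) p"
proof -
  let ?T = "tensor K (tensor K M N) P"
  let ?F = "\<lambda>m n p. pure_tensor K (tensor K M N) P (pure_tensor K M N m n) p"
  note NP = tensor_module[OF N P] and MN = tensor_module[OF M N]
  note T = tensor_module[OF MN P]
  note c = pure_tensor_closed[OF M N]
  have F: "bilinear_map K N P ?T (?F m)" if "m \<in> carrier M" for m
    by (intro bilinear_mapI module_hom_comp[OF pure_tensor_hom(1)[OF M N that]]
        pure_tensor_hom[OF MN P] c that)
  have lin: "(\<lambda>m. ?F m n p) \<in> module_hom K M ?T" if "n \<in> carrier N" "p \<in> carrier P" for n p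
    by (intro module_hom_comp[OF pure_tensor_hom(2)[OF M N]] pure_tensor_hom[OF MN P] that)
  have "bilinear_map K M (tensor K N P) ?T (\<lambda>m Y. tensor_lift K N P ?T (?F m) Y)"
    by (intro bilinear_mapI tensor_lift_param[OF N P T F lin M] tensor_lift(1)[OF N P T F])
  note l = tensor_lift[OF M NP T this]
  show "tensor_unassoc K M N P \<in> module_hom K (tensor K M (tensor K N P)) ?T"
    using l(1) by (simp add: tensor_unassoc_def Let_def)
  show "tensor_unassoc K M N P (pure_tensor K M (tensor K N P) m (pure_tensor K N P n p)) =
      pure_tensor K (tensor K M N) P (pure_tensor K M N m n) p"
    if "m \<in> carrier M" "n \<in> carrier N" "p \<in> carrier P" for m n p
    using l(2)[OF that(1) pure_tensor_closed[OF N P that(2,3)]] tensor_lift(2)[OF N P T F[OF that(1)] that(2,3)]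
    by (simp add: tensor_unassoc_def Let_def)
qed

lemma tensor_middle_pure:
  assumes "module K M" "module K N" "module K N'" "module K P" "module K Q" "module K Q'"
    and f: "f \<in> module_hom K (tensor K N N') (tensor K Q Q')"
    and mem: "m \<in> carrier M" "n \<in> carrier N" "n' \<in> carrier N'" "p \<in> carrier P"
      "q \<in> carrier Q" "q' \<in> carrier Q'"
    and eq: "f (pure_tensor K N N' n n') = pure_tensor K Q Q' q q'"
  shows "tensor_middle K M N N' P Q Q' f
      (pure_tensor K (tensor K M N) (tensor K N' P) (pure_tensor K M N m n) (pure_tensor K N' P n' p)) =
      pure_tensor K (tensor K M Q) (tensor K Q' P) (pure_tensor K M Q m q) (pure_tensor K Q' P q' p)"
proof -
  note mods = assms(1-6) tensor_module
  have g: "tensor_assoc K Q Q' P \<circ> tensor_map K (tensor K N N') P (tensor K Q Q') P f id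
      \<circ> tensor_unassoc K N N' P
      \<in> module_hom K (tensor K N (tensor K N' P)) (tensor K Q (tensor K Q' P))"
    unfolding comp_def
    by (rule module_hom_comp[OF tensor_unassoc(1) module_hom_comp[OF tensor_map(1) tensor_assoc(1)]])
      (intro mods f module_hom_id)+
  show ?thesis
    by (simp add: tensor_middle_def tensor_assoc(2) tensor_unassoc(2) tensor_map(2)[OF _ _ _ _ module_hom_id g]
        tensor_map(2)[OF _ _ _ _ f module_hom_id] mods pure_tensor_closed mem eq)
qed


section \<open>Coalgebras and twisted coproducts\<close>

record ('k, 'c) coalgebra = "('k, 'c) module" +
  comul :: "'c \<Rightarrow> ('k, 'c, 'c) tensor"
  counit :: "'c \<Rightarrow> 'k"

locale coalgebra = vectorspace K C
  for K :: "('k, 'x) ring_scheme" and C :: "('k, 'c, 'y) coalgebra_scheme" +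
  assumes comul_linear: "comul C \<in> module_hom K C (tensor K C C)"
    and counit_linear: "counit C \<in> module_hom K C (ground_vs K)"
    and coassoc: "c \<in> carrier C \<Longrightarrow>
      tensor_assoc K C C C (tensor_map K C C (tensor K C C) C (comul C) id (comul C c)) =
      tensor_map K C C C (tensor K C C) id (comul C) (comul C c)"
    and counit_left: "c \<in> carrier C \<Longrightarrow> contract_left K C C (counit C) (comul C c) = c"
    and counit_right: "c \<in> carrier C \<Longrightarrow> contract_right K C C (counit C) (comul C c) = c"

text \<open>The set \<open>Tw\<close>. The first identity is taken in \<open>D \<otimes> (D \<otimes> C)\<close> and the second in
  \<open>(D \<otimes> C) \<otimes> C\<close>.\<close>

definition Tw ::
  "('k, 'x) ring_scheme \<Rightarrow> ('k, 'c, 'y) coalgebra_scheme \<Rightarrow> ('k, 'd, 'z) coalgebra_scheme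
    \<Rightarrow> (('k, 'd, 'c) tensor \<Rightarrow> ('k, 'd, 'c) tensor) set" where
  "Tw K C D =
    {\<Psi>' \<in> module_hom K (tensor K D C) (tensor K D C).
      \<forall>x\<in>carrier (tensor K D C).
        tensor_assoc K D D C (tensor_map K D C (tensor K D D) C (comul D) id (\<Psi>' x)) =
        tensor_map K D (tensor K D C) D (tensor K D C) id \<Psi>'
          (tensor_assoc K D D C (tensor_map K D C (tensor K D D) C (comul D) id x)) \<and>
        tensor_unassoc K D C C (tensor_map K D C D (tensor K C C) id (comul C) (\<Psi>' x)) =
        tensor_map K (tensor K D C) C (tensor K D C) C \<Psi>' id
          (tensor_unassoc K D C C (tensor_map K D C D (tensor K C C) id (comul C) x))}"

definition twisted_comul ::
  "('k, 'x) ring_scheme \<Rightarrow> ('k, 'c, 'y) coalgebra_scheme \<Rightarrow> ('k, 'd, 'z) coalgebra_scheme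
    \<Rightarrow> (('k, 'c, 'd) tensor \<Rightarrow> ('k, 'd, 'c) tensor) \<Rightarrow> ('k, 'c, 'd) tensor
    \<Rightarrow> ('k, ('k, 'c, 'd) tensor, ('k, 'c, 'd) tensor) tensor" where
  "twisted_comul K C D \<Psi> =
     tensor_middle K C C D D D C \<Psi>
     \<circ> tensor_map K C D (tensor K C C) (tensor K D D) (comul C) (comul D)"

definition twisted_counit ::
  "('k, 'x) ring_scheme \<Rightarrow> ('k, 'c, 'y) coalgebra_scheme \<Rightarrow> ('k, 'd, 'z) coalgebra_scheme
    \<Rightarrow> (('k, 'c, 'd) tensor \<Rightarrow> ('k, 'd, 'c) tensor) \<Rightarrow> (('k, 'c, 'd) tensor \<Rightarrow> 'k) \<Rightarrow> bool" where
  "twisted_counit K C D \<Psi> \<epsilon> \<longleftrightarrow>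
     \<epsilon> \<in> module_hom K (tensor K C D) (ground_vs K) \<and>
     (\<forall>x\<in>carrier (tensor K C D).
        contract_left K (tensor K C D) (tensor K C D) \<epsilon> (twisted_comul K C D \<Psi> x) = x \<and>
        contract_right K (tensor K C D) (tensor K C D) \<epsilon> (twisted_comul K C D \<Psi> x) = x)"

text \<open>For \<open>\<Psi> = \<tau>\<close> the twisted coproduct is the tensor coproduct sending \<open>c \<otimes> d\<close> to
  \<open>(c\<^sub>(\<^sub>1\<^sub>) \<otimes> d\<^sub>(\<^sub>1\<^sub>)) \<otimes> (c\<^sub>(\<^sub>2\<^sub>) \<otimes> d\<^sub>(\<^sub>2\<^sub>))\<close>.\<close>

definition convolution ::
  "('k, 'x) ring_scheme \<Rightarrow> ('k, 'c, 'y) coalgebra_scheme \<Rightarrow> ('k, 'd, 'z) coalgebra_scheme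
    \<Rightarrow> (('k, 'c, 'd) tensor \<Rightarrow> 'k) \<Rightarrow> (('k, 'c, 'd) tensor \<Rightarrow> 'k) \<Rightarrow> ('k, 'c, 'd) tensor \<Rightarrow> 'k" where
  "convolution K C D \<phi> \<phi>' =
     tensor_functional K (tensor K C D) (tensor K C D) \<phi> \<phi>'
     \<circ> twisted_comul K C D (tensor_flip K C D)"

definition convolution_inverse ::
  "('k, 'x) ring_scheme \<Rightarrow> ('k, 'c, 'y) coalgebra_scheme \<Rightarrow> ('k, 'd, 'z) coalgebra_scheme
    \<Rightarrow> (('k, 'c, 'd) tensor \<Rightarrow> 'k) \<Rightarrow> (('k, 'c, 'd) tensor \<Rightarrow> 'k) \<Rightarrow> bool" where
  "convolution_inverse K C D \<phi> \<psi> \<longleftrightarrow>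
     \<psi> \<in> module_hom K (tensor K C D) (ground_vs K) \<and>
     (\<forall>x\<in>carrier (tensor K C D).
        convolution K C D \<phi> \<psi> x = tensor_functional K C D (counit C) (counit D) x \<and>
        convolution K C D \<psi> \<phi> x = tensor_functional K C D (counit C) (counit D) x)"

end

theory Submission
  imports Defs
begin

text \<open>Write \<open>\<Psi>\<close> and \<open>\<phi>\<close> as in the theorem. Membership of \<open>\<Psi>'\<close> in \<open>Tw\<close> says that \<open>\<Psi>'\<close> is a
  morphism of left \<open>D\<close>-comodules and of right \<open>C\<close>-comodules. Such a map between cofree comodules is
  determined by its composite with \<open>\<epsilon>\<^sub>D \<otimes> \<epsilon>\<^sub>C\<close>: applying \<open>\<epsilon>\<^sub>D\<close> and \<open>\<epsilon>\<^sub>C\<close> in the middle of the two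
  defining identities gives
  \<open>\<Psi>(c \<otimes> d) = \<phi>(c\<^sub>1 \<otimes> d\<^sub>2) d\<^sub>1 \<otimes> c\<^sub>2\<close> (\<open>Tw_expand\<close>). Hence
  \<open>\<Delta>\<^sub>\<Psi>(c \<otimes> d) = \<phi>(c\<^sub>2 \<otimes> d\<^sub>2) (c\<^sub>1 \<otimes> d\<^sub>1) \<otimes> (c\<^sub>3 \<otimes> d\<^sub>3)\<close>, and for every functional \<open>\<epsilon>\<close>
  coassociativity yields
  \<open>(\<epsilon> \<otimes> id)\<Delta>\<^sub>\<Psi> = ((\<epsilon> * \<phi>) \<otimes> id)\<Delta>\<^sub>\<tau>\<close> and \<open>(id \<otimes> \<epsilon>)\<Delta>\<^sub>\<Psi> = (id \<otimes> (\<phi> * \<epsilon>))\<Delta>\<^sub>\<tau>\<close>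
  (\<open>contract_twisted_comul\<close>), where \<open>\<Delta>\<^sub>\<tau>\<close> is the usual coproduct of \<open>C \<otimes> D\<close>.

  Since \<open>\<Delta>\<^sub>\<tau>\<close> has the two-sided counit \<open>\<epsilon>\<^sub>C \<otimes> \<epsilon>\<^sub>D\<close>, contracting it with a functional gives the
  identity only if the functional is \<open>\<epsilon>\<^sub>C \<otimes> \<epsilon>\<^sub>D\<close> (\<open>contract_flip_eq_iff\<close>). So \<open>\<epsilon>\<close> is a counit
  for \<open>\<Delta>\<^sub>\<Psi>\<close> exactly when \<open>\<epsilon> * \<phi> = \<epsilon>\<^sub>C \<otimes> \<epsilon>\<^sub>D = \<phi> * \<epsilon>\<close>, that is, exactly when \<open>\<epsilon>\<close> is a convolution
  inverse of \<open>\<phi>\<close> (\<open>twisted_counit_iff_convolution_inverse\<close>). Two counits \<open>\<epsilon>\<close>, \<open>\<epsilon>'\<close> agree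
  because both equal \<open>(\<epsilon> \<otimes> \<epsilon>')\<Delta>\<^sub>\<Psi>\<close>.\<close>


section \<open>Linear maps built from tensors\<close>

lemma ground_vs_carrier [simp]: "carrier (ground_vs K) = carrier K"
  by (simp add: ground_vs_def)

lemma ground_vs_smult [simp]: "a \<odot>\<^bsub>ground_vs K\<^esub> b = a \<otimes>\<^bsub>K\<^esub> b"
  by (simp add: ground_vs_def)

lemma ground_vs_module:
  assumes "cring K"
  shows "module K (ground_vs K)"
proof -
  interpret cring K by fact
  show ?thesis
    by (rule module_criteria) (auto simp: ground_vs_def is_cring l_distr r_distr m_assoc a_ac
        intro: r_neg add.inv_closed)
qed

lemma hom_closed: "h \<in> module_hom K M N \<Longrightarrow> x \<in> carrier M \<Longrightarrow> h x \<in> carrier N"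
  by (auto simp: module_hom_def)

lemma tensor_lift_cong:
  assumes "\<And>m n. m \<in> carrier M \<Longrightarrow> n \<in> carrier N \<Longrightarrow> f m n = g m n"
  shows "tensor_lift K M N P f = tensor_lift K M N P g"
  using assms by (simp add: tensor_lift_def)

lemma hom_smult_left:
  assumes N: "module K N" and f: "f \<in> module_hom K P (ground_vs K)" and n: "n \<in> carrier N"
  shows "(\<lambda>x. f x \<odot>\<^bsub>N\<^esub> n) \<in> module_hom K P N"
proof -
  interpret N: module K N by (rule N)
  show ?thesis using f n
    by (auto simp: module_hom_def ground_vs_def Pi_iff N.smult_l_distr N.smult_assoc1)
qed

lemma hom_pure_tensor_left:
  assumes M: "module K M" and N: "module K N"
    and f: "f \<in> module_hom K P M" and n: "n \<in> carrier N"
  shows "(\<lambda>x. pure_tensor K M N (f x) n) \<in> module_hom K P (tensor K M N)"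
  using module_hom_comp[OF f pure_tensor_hom(2)[OF M N n]] .

lemma hom_pure_tensor_right:
  assumes M: "module K M" and N: "module K N"
    and f: "f \<in> module_hom K P N" and m: "m \<in> carrier M"
  shows "(\<lambda>x. pure_tensor K M N m (f x)) \<in> module_hom K P (tensor K M N)"
  using module_hom_comp[OF f pure_tensor_hom(1)[OF M N m]] .

lemma hom_ident: "(\<lambda>x. x) \<in> module_hom K M M"
  by (simp add: module_hom_def)

text \<open>A linear map on a tensor product is the lift of its restriction to pure tensors. Applied to
  \<open>X = \<Delta>(c)\<close> this is what turns a composite of structure maps into a Sweedler expression.\<close>

lemma tensor_hom_expand:
  assumes M: "module K M" and N: "module K N" and P: "module K P"
    and h: "h \<in> module_hom K (tensor K M N) P" and X: "X \<in> carrier (tensor K M N)"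
  shows "h X = tensor_lift K M N P (\<lambda>m n. h (pure_tensor K M N m n)) X"
proof -
  have "bilinear_map K M N P (\<lambda>m n. h (pure_tensor K M N m n))"
    by (intro bilinear_mapI module_hom_comp[OF _ h] pure_tensor_hom M N)
  note l = tensor_lift[OF M N P this]
  show ?thesis by (rule tensor_hom_eqI[OF M N P h l(1) l(2)[symmetric] X])
qed

lemma hom_tensor_lift:
  assumes M: "module K M" and N: "module K N" and P: "module K P" and Q: "module K Q"
    and g: "g \<in> module_hom K P Q" and f: "bilinear_map K M N P f"
    and X: "X \<in> carrier (tensor K M N)"
  shows "g (tensor_lift K M N P f X) = tensor_lift K M N Q (\<lambda>m n. g (f m n)) X"
proof -
  note l = tensor_lift[OF M N P f]
  have "g (tensor_lift K M N P f X) =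
      tensor_lift K M N Q (\<lambda>m n. g (tensor_lift K M N P f (pure_tensor K M N m n))) X"
    by (rule tensor_hom_expand[OF M N Q module_hom_comp[OF l(1) g] X])
  also have "\<dots> = tensor_lift K M N Q (\<lambda>m n. g (f m n)) X"
    by (simp add: l(2) cong: tensor_lift_cong)
  finally show ?thesis .
qed

text \<open>The Fubini rule for lifts: both sides are linear in \<open>X\<close>, and they agree on pure tensors.\<close>

lemma tensor_lift_commute:
  assumes M: "module K M" and N: "module K N" and M': "module K M'" and N': "module K N'"
    and P: "module K P"
    and F: "\<And>a b. a \<in> carrier M \<Longrightarrow> b \<in> carrier N \<Longrightarrow> bilinear_map K M' N' P (F a b)"
      "\<And>c d. c \<in> carrier M' \<Longrightarrow> d \<in> carrier N' \<Longrightarrow> bilinear_map K M N P (\<lambda>a b. F a b c d)"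
    and X: "X \<in> carrier (tensor K M N)" and Y: "Y \<in> carrier (tensor K M' N')"
  shows "tensor_lift K M N P (\<lambda>a b. tensor_lift K M' N' P (F a b) Y) X =
    tensor_lift K M' N' P (\<lambda>c d. tensor_lift K M N P (\<lambda>a b. F a b c d) X) Y"
proof -
  let ?g = "\<lambda>X. tensor_lift K M' N' P (\<lambda>c d. tensor_lift K M N P (\<lambda>a b. F a b c d) X) Y"
  note l = tensor_lift[OF M N P F(2)]
  have homs: "\<And>d. d \<in> carrier N' \<Longrightarrow> (\<lambda>c. F a b c d) \<in> module_hom K M' P"
    "\<And>c. c \<in> carrier M' \<Longrightarrow> F a b c \<in> module_hom K N' P"
    if "a \<in> carrier M" "b \<in> carrier N" for a b
    using F(1)[of a b] that by (auto simp: bilinear_map_def)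
  have b: "bilinear_map K M' N' P (\<lambda>c d. tensor_lift K M N P (\<lambda>a b. F a b c d) X)"
    if X: "X \<in> carrier (tensor K M N)" for X
    by (rule bilinear_mapI; rule tensor_lift_param[OF M N P _ _ _ X]) (auto intro: F homs M' N')
  have g: "?g \<in> module_hom K (tensor K M N) P"
    by (intro tensor_lift_param[OF M' N' P _ _ _ Y] tensor_module[OF M N] b l(1))
  have "?g X = tensor_lift K M N P (\<lambda>a b. ?g (pure_tensor K M N a b)) X"
    by (rule tensor_hom_expand[OF M N P g X])
  also have "\<dots> = tensor_lift K M N P (\<lambda>a b. tensor_lift K M' N' P (F a b) Y) X"
    by (simp add: l(2) cong: tensor_lift_cong)
  finally show ?thesis by simp
qed

lemma tensor_middle:
  assumes M: "module K M" and N: "module K N" and N': "module K N'" and P: "module K P"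
    and Q: "module K Q" and Q': "module K Q'"
    and f: "f \<in> module_hom K (tensor K N N') (tensor K Q Q')"
  shows "tensor_middle K M N N' P Q Q' f \<in>
      module_hom K (tensor K (tensor K M N) (tensor K N' P)) (tensor K (tensor K M Q) (tensor K Q' P))"
    and "\<And>m n n' p. \<lbrakk>m \<in> carrier M; n \<in> carrier N; n' \<in> carrier N'; p \<in> carrier P\<rbrakk> \<Longrightarrow>
      tensor_middle K M N N' P Q Q' f
        (pure_tensor K (tensor K M N) (tensor K N' P) (pure_tensor K M N m n) (pure_tensor K N' P n' p)) =
      tensor_unassoc K M Q (tensor K Q' P) (pure_tensor K M (tensor K Q (tensor K Q' P)) m
        (tensor_assoc K Q Q' P (pure_tensor K (tensor K Q Q') P (f (pure_tensor K N N' n n')) p)))"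
proof -
  note mods = M N N' P Q Q' tensor_module
  let ?g = "tensor_assoc K Q Q' P \<circ> tensor_map K (tensor K N N') P (tensor K Q Q') P f id
      \<circ> tensor_unassoc K N N' P"
  have g: "?g \<in> module_hom K (tensor K N (tensor K N' P)) (tensor K Q (tensor K Q' P))"
    unfolding comp_def
    by (rule module_hom_comp[OF tensor_unassoc(1) module_hom_comp[OF tensor_map(1) tensor_assoc(1)]])
      (intro mods f module_hom_id)+
  show "tensor_middle K M N N' P Q Q' f \<in>
      module_hom K (tensor K (tensor K M N) (tensor K N' P)) (tensor K (tensor K M Q) (tensor K Q' P))"
    unfolding tensor_middle_def comp_def[of _ "tensor_assoc K M N (tensor K N' P)"]
      comp_def[of "tensor_unassoc K M Q (tensor K Q' P)"]
    by (rule module_hom_comp[OF tensor_assoc(1) module_hom_comp[OF tensor_map(1) tensor_unassoc(1)]])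
      (intro mods g module_hom_id)+
  fix m n n' p
  assume mem: "m \<in> carrier M" "n \<in> carrier N" "n' \<in> carrier N'" "p \<in> carrier P"
  show "tensor_middle K M N N' P Q Q' f
        (pure_tensor K (tensor K M N) (tensor K N' P) (pure_tensor K M N m n) (pure_tensor K N' P n' p)) =
      tensor_unassoc K M Q (tensor K Q' P) (pure_tensor K M (tensor K Q (tensor K Q' P)) m
        (tensor_assoc K Q Q' P (pure_tensor K (tensor K Q Q') P (f (pure_tensor K N N' n n')) p)))"
    by (simp add: tensor_middle_def tensor_assoc(2) tensor_unassoc(2)
        tensor_map(2)[OF _ _ _ _ module_hom_id g]
        tensor_map(2)[OF _ _ _ _ f module_hom_id] mods pure_tensor_closed mem)
qed

lemma contract_left:
  assumes M: "module K M" and N: "module K N" and \<alpha>: "\<alpha> \<in> module_hom K M (ground_vs K)"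
  shows "contract_left K M N \<alpha> \<in> module_hom K (tensor K M N) N"
    and "\<And>m n. \<lbrakk>m \<in> carrier M; n \<in> carrier N\<rbrakk> \<Longrightarrow>
      contract_left K M N \<alpha> (pure_tensor K M N m n) = \<alpha> m \<odot>\<^bsub>N\<^esub> n"
proof -
  have "bilinear_map K M N N (\<lambda>m n. \<alpha> m \<odot>\<^bsub>N\<^esub> n)"
    using hom_closed[OF \<alpha>]
    by (intro bilinear_mapI hom_smult_left[OF N \<alpha>] module_hom_smultI[OF N hom_ident]) auto
  note l = tensor_lift[OF M N N this]
  show "contract_left K M N \<alpha> \<in> module_hom K (tensor K M N) N"
    and "\<And>m n. \<lbrakk>m \<in> carrier M; n \<in> carrier N\<rbrakk> \<Longrightarrow>
      contract_left K M N \<alpha> (pure_tensor K M N m n) = \<alpha> m \<odot>\<^bsub>N\<^esub> n"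
    using l by (auto simp: contract_left_def)
qed

lemma contract_right:
  assumes M: "module K M" and N: "module K N" and \<beta>: "\<beta> \<in> module_hom K N (ground_vs K)"
  shows "contract_right K M N \<beta> \<in> module_hom K (tensor K M N) M"
    and "\<And>m n. \<lbrakk>m \<in> carrier M; n \<in> carrier N\<rbrakk> \<Longrightarrow>
      contract_right K M N \<beta> (pure_tensor K M N m n) = \<beta> n \<odot>\<^bsub>M\<^esub> m"
proof -
  have "bilinear_map K M N M (\<lambda>m n. \<beta> n \<odot>\<^bsub>M\<^esub> m)"
    using hom_closed[OF \<beta>]
    by (intro bilinear_mapI hom_smult_left[OF M \<beta>] module_hom_smultI[OF M hom_ident]) auto
  note l = tensor_lift[OF M N M this]
  show "contract_right K M N \<beta> \<in> module_hom K (tensor K M N) M"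
    and "\<And>m n. \<lbrakk>m \<in> carrier M; n \<in> carrier N\<rbrakk> \<Longrightarrow>
      contract_right K M N \<beta> (pure_tensor K M N m n) = \<beta> n \<odot>\<^bsub>M\<^esub> m"
    using l by (auto simp: contract_right_def)
qed

text \<open>The last two identities say that both factors can be contracted in either order. They carry
  every uniqueness argument about counits, by evaluating one \<open>(\<alpha> \<otimes> \<beta>)\<Delta>\<close> in two ways.\<close>

lemma tensor_functional_props:
  assumes M: "module K M" and N: "module K N"
    and \<alpha>: "\<alpha> \<in> module_hom K M (ground_vs K)" and \<beta>: "\<beta> \<in> module_hom K N (ground_vs K)"
  shows "tensor_functional K M N \<alpha> \<beta> \<in> module_hom K (tensor K M N) (ground_vs K)"
    and "\<And>m n. \<lbrakk>m \<in> carrier M; n \<in> carrier N\<rbrakk> \<Longrightarrow>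
      tensor_functional K M N \<alpha> \<beta> (pure_tensor K M N m n) = \<alpha> m \<otimes>\<^bsub>K\<^esub> \<beta> n"
    and "\<And>X. X \<in> carrier (tensor K M N) \<Longrightarrow>
      tensor_functional K M N \<alpha> \<beta> X = \<beta> (contract_left K M N \<alpha> X)"
    and "\<And>X. X \<in> carrier (tensor K M N) \<Longrightarrow>
      tensor_functional K M N \<alpha> \<beta> X = \<alpha> (contract_right K M N \<beta> X)"
proof -
  interpret M: module K M by (rule M)
  note k = ground_vs_module[OF M.R.is_cring]
  note ac = hom_closed[OF \<alpha>, simplified] and bc = hom_closed[OF \<beta>, simplified]
  have "bilinear_map K M N (ground_vs K) (\<lambda>m n. \<alpha> m \<odot>\<^bsub>ground_vs K\<^esub> \<beta> n)"
    by (intro bilinear_mapI hom_smult_left[OF k \<alpha>] module_hom_smultI[OF k \<beta>]) (use ac bc in auto)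
  then have "bilinear_map K M N (ground_vs K) (\<lambda>m n. \<alpha> m \<otimes>\<^bsub>K\<^esub> \<beta> n)" by simp
  note l = tensor_lift[OF M N k this, folded tensor_functional_def]
  show "tensor_functional K M N \<alpha> \<beta> \<in> module_hom K (tensor K M N) (ground_vs K)"
    and "\<And>m n. \<lbrakk>m \<in> carrier M; n \<in> carrier N\<rbrakk> \<Longrightarrow>
      tensor_functional K M N \<alpha> \<beta> (pure_tensor K M N m n) = \<alpha> m \<otimes>\<^bsub>K\<^esub> \<beta> n"
    using l by auto
  note cl = contract_left[OF M N \<alpha>] and cr = contract_right[OF M N \<beta>]
  show "tensor_functional K M N \<alpha> \<beta> X = \<beta> (contract_left K M N \<alpha> X)"
    if X: "X \<in> carrier (tensor K M N)" for X
    by (rule tensor_hom_eqI[OF M N k l(1) module_hom_comp[OF cl(1) \<beta>] _ X])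
      (simp add: l(2) cl(2) module_hom_smult[OF \<beta>] ac)
  show "tensor_functional K M N \<alpha> \<beta> X = \<alpha> (contract_right K M N \<beta> X)"
    if X: "X \<in> carrier (tensor K M N)" for X
    by (rule tensor_hom_eqI[OF M N k l(1) module_hom_comp[OF cr(1) \<alpha>] _ X])
      (simp add: l(2) cr(2) module_hom_smult[OF \<alpha>] ac bc M.R.m_comm)
qed


section \<open>Sweedler notation\<close>

text \<open>This is \<open>f(c\<^sub>1, c\<^sub>2)\<close> in Sweedler notation. Nested uses render expressions such as
  \<open>F(c\<^sub>1, c\<^sub>2, c\<^sub>3)\<close>, and the lift makes the implicit sum independent of any chosen representation
  of \<open>\<Delta>(c)\<close> by pure tensors.\<close>

definition sweedler ::
  "('k, 'x) ring_scheme \<Rightarrow> ('k, 'c, 'y) coalgebra_scheme \<Rightarrow> ('k, 'p, 'w) module_scheme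
    \<Rightarrow> ('c \<Rightarrow> 'c \<Rightarrow> 'p) \<Rightarrow> 'c \<Rightarrow> 'p" where
  "sweedler K C P f c = tensor_lift K C C P f (comul C c)"

lemma sweedler_cong:
  assumes "\<And>a b. a \<in> carrier C \<Longrightarrow> b \<in> carrier C \<Longrightarrow> f a b = g a b"
  shows "sweedler K C P f = sweedler K C P g"
  unfolding sweedler_def by (intro ext fun_cong[OF tensor_lift_cong] assms)

context coalgebra
begin

lemma comul_closed: "c \<in> carrier C \<Longrightarrow> comul C c \<in> carrier (tensor K C C)"
  using comul_linear by (rule hom_closed)

lemma sweedler_linear:
  assumes P: "module K P" and f: "bilinear_map K C C P f" and g: "g \<in> module_hom K L C"
  shows "(\<lambda>x. sweedler K C P f (g x)) \<in> module_hom K L P"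
  unfolding sweedler_def
  by (rule module_hom_comp[OF module_hom_comp[OF g comul_linear]
        tensor_lift(1)[OF module_axioms module_axioms P f]])

lemma sweedler_linear_param:
  assumes P: "module K P" and L: "module K L"
    and f: "\<And>x. x \<in> carrier L \<Longrightarrow> bilinear_map K C C P (F x)"
    and lin: "\<And>a b. a \<in> carrier C \<Longrightarrow> b \<in> carrier C \<Longrightarrow> (\<lambda>x. F x a b) \<in> module_hom K L P"
    and c: "c \<in> carrier C"
  shows "(\<lambda>x. sweedler K C P (F x) c) \<in> module_hom K L P"
  unfolding sweedler_def
  by (rule tensor_lift_param[OF module_axioms module_axioms P f lin L comul_closed[OF c]])

lemma hom_sweedler:
  assumes P: "module K P" and Q: "module K Q" and g: "g \<in> module_hom K P Q"
    and f: "bilinear_map K C C P f" and c: "c \<in> carrier C"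
  shows "g (sweedler K C P f c) = sweedler K C Q (\<lambda>a b. g (f a b)) c"
  unfolding sweedler_def
  by (rule hom_tensor_lift[OF module_axioms module_axioms P Q g f comul_closed[OF c]])

lemma sweedler_commute:
  assumes D: "coalgebra K D" and P: "module K P"
    and "\<And>a b. a \<in> carrier C \<Longrightarrow> b \<in> carrier C \<Longrightarrow> bilinear_map K D D P (F a b)"
    and "\<And>a b. a \<in> carrier D \<Longrightarrow> b \<in> carrier D \<Longrightarrow> bilinear_map K C C P (\<lambda>p q. F p q a b)"
    and "c \<in> carrier C" "d \<in> carrier D"
  shows "sweedler K C P (\<lambda>p q. sweedler K D P (F p q) d) c =
    sweedler K D P (\<lambda>a b. sweedler K C P (\<lambda>p q. F p q a b) c) d"
proof -
  interpret D: coalgebra K D by (rule D)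
  show ?thesis
    unfolding sweedler_def
    by (rule tensor_lift_commute[OF module_axioms module_axioms D.module_axioms D.module_axioms P])
      (use assms comul_closed D.comul_closed in auto)
qed

text \<open>Coassociativity as it is used with Sweedler notation: the expression \<open>F(c\<^sub>1, c\<^sub>2, c\<^sub>3)\<close> has one
  meaning for trilinear \<open>F\<close>. Both sides are the linear map induced by \<open>F\<close> on \<open>C \<otimes> (C \<otimes> C)\<close>,
  evaluated at the two sides of the coassociativity law.\<close>

lemma sweedler_coassoc:
  assumes P: "module K P"
    and F1: "\<And>p q. p \<in> carrier C \<Longrightarrow> q \<in> carrier C \<Longrightarrow> (\<lambda>a. F a p q) \<in> module_hom K C P"
    and F2: "\<And>a q. a \<in> carrier C \<Longrightarrow> q \<in> carrier C \<Longrightarrow> (\<lambda>p. F a p q) \<in> module_hom K C P"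
    and F3: "\<And>a p. a \<in> carrier C \<Longrightarrow> p \<in> carrier C \<Longrightarrow> (\<lambda>q. F a p q) \<in> module_hom K C P"
    and c: "c \<in> carrier C"
  shows "sweedler K C P (\<lambda>w q. sweedler K C P (\<lambda>a p. F a p q) w) c =
    sweedler K C P (\<lambda>a w. sweedler K C P (\<lambda>p q. F a p q) w) c"
proof -
  let ?CC = "tensor K C C"
  note m = module_axioms and mm = tensor_module[OF module_axioms module_axioms]
  have bil: "bilinear_map K C C P (F a)" if "a \<in> carrier C" for a
    by (rule bilinear_mapI) (use F2 F3 that in auto)
  have bilL: "bilinear_map K C ?CC P (\<lambda>a Y. tensor_lift K C C P (F a) Y)"
    by (rule bilinear_mapI)
      (use tensor_lift_param[OF m m P bil F1 m] tensor_lift(1)[OF m m P bil] in auto)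
  define L where "L = tensor_lift K C ?CC P (\<lambda>a Y. tensor_lift K C C P (F a) Y)"
  note L = tensor_lift[OF m mm P bilL, folded L_def]
  note as = tensor_assoc[OF m m m]
  note id = module_hom_id[of K C]
  note map1 = tensor_map[OF m m mm m comul_linear id]
  note map2 = tensor_map[OF m m m mm id comul_linear]
  have assoc: "L (tensor_assoc K C C C (pure_tensor K ?CC C Y q)) =
      tensor_lift K C C P (\<lambda>a p. F a p q) Y"
    if Y: "Y \<in> carrier ?CC" and q: "q \<in> carrier C" for Y q
  proof -
    have "(\<lambda>Y. L (tensor_assoc K C C C (pure_tensor K ?CC C Y q))) \<in> module_hom K ?CC P"
      by (rule module_hom_comp[OF module_hom_comp[OF pure_tensor_hom(2)[OF mm m q] as(1)] L(1)])
    from tensor_hom_expand[OF m m P this Y]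
    have "L (tensor_assoc K C C C (pure_tensor K ?CC C Y q)) =
      tensor_lift K C C P (\<lambda>a p. L (tensor_assoc K C C C
        (pure_tensor K ?CC C (pure_tensor K C C a p) q))) Y" .
    also have "\<dots> = tensor_lift K C C P (\<lambda>a p. F a p q) Y"
      using q by (simp add: as(2) L(2) tensor_lift(2)[OF m m P bil] pure_tensor_closed[OF m m]
          cong: tensor_lift_cong)
    finally show ?thesis .
  qed
  have "sweedler K C P (\<lambda>w q. sweedler K C P (\<lambda>a p. F a p q) w) c =
      tensor_lift K C C P (\<lambda>w q. L (tensor_assoc K C C C (tensor_map K C C ?CC C (comul C) id
        (pure_tensor K C C w q)))) (comul C c)"
    by (simp add: sweedler_def map1(2) assoc comul_closed cong: tensor_lift_cong)
  also have "\<dots> = L (tensor_assoc K C C C (tensor_map K C C ?CC C (comul C) id (comul C c)))"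
    by (rule tensor_hom_expand[OF m m P _ comul_closed[OF c], symmetric])
      (rule module_hom_comp[OF module_hom_comp[OF map1(1) as(1)] L(1)])
  also have "\<dots> = L (tensor_map K C C C ?CC id (comul C) (comul C c))"
    by (simp add: coassoc c)
  also have "\<dots> = tensor_lift K C C P (\<lambda>a w. L (tensor_map K C C C ?CC id (comul C)
        (pure_tensor K C C a w))) (comul C c)"
    by (rule tensor_hom_expand[OF m m P module_hom_comp[OF map2(1) L(1)] comul_closed[OF c]])
  also have "\<dots> = sweedler K C P (\<lambda>a w. sweedler K C P (\<lambda>p q. F a p q) w) c"
    by (simp add: sweedler_def map2(2) L(2) comul_closed cong: tensor_lift_cong)
  finally show ?thesis .
qed

lemma counit_closed: "c \<in> carrier C \<Longrightarrow> counit C c \<in> carrier K"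
  using hom_closed[OF counit_linear] by simp

lemma sweedler_counit_left:
  assumes P: "module K P" and g: "g \<in> module_hom K C P" and c: "c \<in> carrier C"
  shows "sweedler K C P (\<lambda>a b. counit C a \<odot>\<^bsub>P\<^esub> g b) c = g c"
proof -
  note m = module_axioms
  have b: "bilinear_map K C C C (\<lambda>a b. counit C a \<odot>\<^bsub>C\<^esub> b)"
    using counit_linear module_hom_id[of K C]
    by (intro bilinear_mapI hom_smult_left module_hom_smultI m counit_closed) (auto simp: id_def)
  have "g c = g (sweedler K C C (\<lambda>a b. counit C a \<odot>\<^bsub>C\<^esub> b) c)"
    using counit_left[OF c] by (simp add: contract_left_def sweedler_def)
  also have "\<dots> = sweedler K C P (\<lambda>a b. g (counit C a \<odot>\<^bsub>C\<^esub> b)) c"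
    by (rule hom_sweedler[OF m P g b c])
  also have "\<dots> = sweedler K C P (\<lambda>a b. counit C a \<odot>\<^bsub>P\<^esub> g b) c"
    by (rule fun_cong[OF sweedler_cong]) (use module_hom_smult[OF g] counit_closed in auto)
  finally show ?thesis by simp
qed

lemma sweedler_counit_right:
  assumes P: "module K P" and g: "g \<in> module_hom K C P" and c: "c \<in> carrier C"
  shows "sweedler K C P (\<lambda>a b. counit C b \<odot>\<^bsub>P\<^esub> g a) c = g c"
proof -
  note m = module_axioms
  have b: "bilinear_map K C C C (\<lambda>a b. counit C b \<odot>\<^bsub>C\<^esub> a)"
    using counit_linear module_hom_id[of K C]
    by (intro bilinear_mapI hom_smult_left module_hom_smultI m counit_closed) (auto simp: id_def)
  have "g c = g (sweedler K C C (\<lambda>a b. counit C b \<odot>\<^bsub>C\<^esub> a) c)"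
    using counit_right[OF c] by (simp add: contract_right_def sweedler_def)
  also have "\<dots> = sweedler K C P (\<lambda>a b. g (counit C b \<odot>\<^bsub>C\<^esub> a)) c"
    by (rule hom_sweedler[OF m P g b c])
  also have "\<dots> = sweedler K C P (\<lambda>a b. counit C b \<odot>\<^bsub>P\<^esub> g a) c"
    by (rule fun_cong[OF sweedler_cong]) (use module_hom_smult[OF g] counit_closed in auto)
  finally show ?thesis by simp
qed

end


section \<open>Expanding the twisted coproduct\<close>

locale coalgebra_pair = C: coalgebra K C + D: coalgebra K D
  for K :: "('k, 'x) ring_scheme" and C :: "('k, 'c, 'y) coalgebra_scheme"
    and D :: "('k, 'd, 'z) coalgebra_scheme"
begin

abbreviation "CD \<equiv> tensor K C D"
abbreviation "cd \<equiv> pure_tensor K C D"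
abbreviation "dc \<equiv> pure_tensor K D C"
abbreviation "cdcd a r q b \<equiv> pure_tensor K CD CD (cd a r) (cd q b)"

lemmas modules = C.module_axioms D.module_axioms tensor_module
  ground_vs_module[OF C.R.is_cring]

text \<open>Backward chaining with these rules proves linearity of a nested Sweedler expression in any one
  of its variables, provided that the variable occurs exactly once: at each node only the rule for
  the argument containing it unifies, since the other arguments must be constant.\<close>

lemmas linear_intros = bilinear_mapI hom_ident hom_pure_tensor_left hom_pure_tensor_right
  hom_smult_left module_hom_smultI C.sweedler_linear C.sweedler_linear_param
  D.sweedler_linear D.sweedler_linear_param modules pure_tensor_closed

lemma twisted_comul_linear:
  assumes "\<Psi> \<in> module_hom K CD (tensor K D C)"
  shows "twisted_comul K C D \<Psi> \<in> module_hom K CD (tensor K CD CD)"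
  unfolding twisted_comul_def comp_def
  by (rule module_hom_comp[OF tensor_map(1) tensor_middle(1)])
    (intro modules C.comul_linear D.comul_linear assms)+

text \<open>In Sweedler notation, \<open>\<Delta>\<^sub>\<Psi>(c \<otimes> d) = c\<^sub>1 \<otimes> \<Psi>(c\<^sub>2 \<otimes> d\<^sub>1) \<otimes> d\<^sub>2\<close>. The linear map \<open>h\<close> stands for the
  contractions and functionals to be applied to this element.\<close>

lemma twisted_comul_expand:
  assumes \<Psi>: "\<Psi> \<in> module_hom K CD (tensor K D C)" and P: "module K P"
    and h: "h \<in> module_hom K (tensor K CD CD) P"
    and c: "c \<in> carrier C" and d: "d \<in> carrier D"
  shows "h (twisted_comul K C D \<Psi> (cd c d)) =
    sweedler K C P (\<lambda>a c'. sweedler K D P (\<lambda>d' b.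
      h (tensor_unassoc K C D CD (pure_tensor K C (tensor K D CD) a
        (tensor_assoc K D C D (pure_tensor K (tensor K D C) D (\<Psi> (cd c' d')) b))))) d) c"
proof -
  let ?CC = "tensor K C C" and ?DD = "tensor K D D"
  let ?m = "\<lambda>Z. h (tensor_middle K C C D D D C \<Psi> Z)"
  note mC = C.module_axioms and mD = D.module_axioms
  note mCC = tensor_module[OF mC mC] and mDD = tensor_module[OF mD mD]
  note mid = tensor_middle[OF mC mC mD mD mD mC \<Psi>]
  note m = module_hom_comp[OF mid(1) h]
  have inner: "?m (pure_tensor K ?CC ?DD X (comul D d)) = tensor_lift K D D P (\<lambda>d' b.
      ?m (pure_tensor K ?CC ?DD X (pure_tensor K D D d' b))) (comul D d)"
    if "X \<in> carrier ?CC" for X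
    by (rule tensor_hom_expand[OF mD mD P _ D.comul_closed[OF d]])
      (rule module_hom_comp[OF pure_tensor_hom(1)[OF mCC mDD that] m])
  have "h (twisted_comul K C D \<Psi> (cd c d)) = ?m (pure_tensor K ?CC ?DD (comul C c) (comul D d))"
    using tensor_map(2)[OF mC mD mCC mDD C.comul_linear D.comul_linear c d]
    by (simp add: twisted_comul_def)
  also have "\<dots> = tensor_lift K C C P (\<lambda>a c'.
      ?m (pure_tensor K ?CC ?DD (pure_tensor K C C a c') (comul D d))) (comul C c)"
    by (rule tensor_hom_expand[OF mC mC P _ C.comul_closed[OF c]])
      (rule module_hom_comp[OF pure_tensor_hom(2)[OF mCC mDD D.comul_closed[OF d]] m])
  also have "\<dots> = sweedler K C P (\<lambda>a c'. sweedler K D P (\<lambda>d' b.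
      h (tensor_unassoc K C D CD (pure_tensor K C (tensor K D CD) a
        (tensor_assoc K D C D (pure_tensor K (tensor K D C) D (\<Psi> (cd c' d')) b))))) d) c"
    by (simp add: sweedler_def inner mid(2) pure_tensor_closed mC cong: tensor_lift_cong)
  finally show ?thesis .
qed

lemma flip_comul_expand:
  assumes P: "module K P" and h: "h \<in> module_hom K (tensor K CD CD) P"
    and c: "c \<in> carrier C" and d: "d \<in> carrier D"
  shows "h (twisted_comul K C D (tensor_flip K C D) (cd c d)) =
    sweedler K C P (\<lambda>a q. sweedler K D P (\<lambda>r b. h (cdcd a r q b)) d) c"
  unfolding twisted_comul_expand[OF tensor_flip(1)[OF C.module_axioms D.module_axioms] P h c d]
  by (simp add: tensor_flip(2) tensor_assoc(2) tensor_unassoc(2) modules pure_tensor_closed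
      cong: sweedler_cong)


section \<open>Twisting maps are determined by a functional\<close>

lemma comul_left_expand:
  assumes P: "module K P" and H: "H \<in> module_hom K (tensor K D (tensor K D C)) P"
    and d: "d \<in> carrier D" and c: "c \<in> carrier C"
  shows "H (tensor_assoc K D D C (tensor_map K D C (tensor K D D) C (comul D) id (dc d c))) =
    sweedler K D P (\<lambda>r s. H (pure_tensor K D (tensor K D C) r (dc s c))) d"
proof -
  let ?DD = "tensor K D D"
  note mC = C.module_axioms and mD = D.module_axioms
  note mDD = tensor_module[OF mD mD]
  note as = tensor_assoc[OF mD mD mC]
  have "H (tensor_assoc K D D C (pure_tensor K ?DD C (comul D d) c)) = tensor_lift K D D P
      (\<lambda>r s. H (tensor_assoc K D D C (pure_tensor K ?DD C (pure_tensor K D D r s) c))) (comul D d)"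
    by (rule tensor_hom_expand[OF mD mD P _ D.comul_closed[OF d]])
      (rule module_hom_comp[OF module_hom_comp[OF pure_tensor_hom(2)[OF mDD mC c] as(1)] H])
  then show ?thesis
    by (simp add: tensor_map(2)[OF mD mC mDD mC D.comul_linear module_hom_id d c] as(2) c
        sweedler_def cong: tensor_lift_cong)
qed

lemma comul_right_expand:
  assumes P: "module K P" and H: "H \<in> module_hom K (tensor K (tensor K D C) C) P"
    and d: "d \<in> carrier D" and c: "c \<in> carrier C"
  shows "H (tensor_unassoc K D C C (tensor_map K D C D (tensor K C C) id (comul C) (dc d c))) =
    sweedler K C P (\<lambda>p q. H (pure_tensor K (tensor K D C) C (dc d p) q)) c"
proof -
  let ?CC = "tensor K C C"
  note mC = C.module_axioms and mD = D.module_axioms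
  note mCC = tensor_module[OF mC mC]
  note as = tensor_unassoc[OF mD mC mC]
  have "H (tensor_unassoc K D C C (pure_tensor K D ?CC d (comul C c))) = tensor_lift K C C P
      (\<lambda>p q. H (tensor_unassoc K D C C (pure_tensor K D ?CC d (pure_tensor K C C p q)))) (comul C c)"
    by (rule tensor_hom_expand[OF mC mC P _ C.comul_closed[OF c]])
      (rule module_hom_comp[OF module_hom_comp[OF pure_tensor_hom(1)[OF mD mCC d] as(1)] H])
  then show ?thesis
    by (simp add: tensor_map(2)[OF mD mC mD mCC module_hom_id C.comul_linear d c] as(2) d
        sweedler_def cong: tensor_lift_cong)
qed

lemma counit_comul_left:
  assumes X: "X \<in> carrier (tensor K D C)"
  shows "tensor_map K D (tensor K D C) D C id (contract_left K D C (counit D))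
    (tensor_assoc K D D C (tensor_map K D C (tensor K D D) C (comul D) id X)) = X"
proof -
  note mC = C.module_axioms and mD = D.module_axioms
  note mDD = tensor_module[OF mD mD] and mDC = tensor_module[OF mD mC]
  note cl = contract_left[OF mD mC D.counit_linear]
  note E = tensor_map[OF mD mDC mD mC module_hom_id cl(1)]
  let ?E = "tensor_map K D (tensor K D C) D C id (contract_left K D C (counit D))"
  note hom = module_hom_comp[OF module_hom_comp[OF
      tensor_map(1)[OF mD mC mDD mC D.comul_linear module_hom_id] tensor_assoc(1)[OF mD mD mC]] E(1)]
  show ?thesis
  proof (rule tensor_hom_eqI[OF mD mC mDC hom hom_ident _ X])
    fix d c assume dc: "d \<in> carrier D" "c \<in> carrier C"
    have "?E (tensor_assoc K D D C (tensor_map K D C (tensor K D D) C (comul D) id (dc d c))) =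
        sweedler K D (tensor K D C) (\<lambda>r s. counit D s \<odot>\<^bsub>tensor K D C\<^esub> dc r c) d"
      unfolding comul_left_expand[OF mDC E(1) dc]
      by (rule fun_cong[OF sweedler_cong])
        (use dc in \<open>simp add: E(2) cl(2) pure_tensor_closed[OF mD mC] D.counit_closed
           module_hom_smult[OF pure_tensor_hom(1)[OF mD mC]]\<close>)
    also have "\<dots> = dc d c"
      by (rule D.sweedler_counit_right[OF mDC pure_tensor_hom(2)[OF mD mC dc(2)] dc(1)])
    finally show "?E (tensor_assoc K D D C (tensor_map K D C (tensor K D D) C (comul D) id (dc d c))) = dc d c" .
  qed
qed

lemma counit_comul_right:
  assumes X: "X \<in> carrier (tensor K D C)"
  shows "tensor_map K (tensor K D C) C D C (contract_right K D C (counit C)) id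
    (tensor_unassoc K D C C (tensor_map K D C D (tensor K C C) id (comul C) X)) = X"
proof -
  note mC = C.module_axioms and mD = D.module_axioms
  note mCC = tensor_module[OF mC mC] and mDC = tensor_module[OF mD mC]
  note cr = contract_right[OF mD mC C.counit_linear]
  note E = tensor_map[OF mDC mC mD mC cr(1) module_hom_id]
  let ?E = "tensor_map K (tensor K D C) C D C (contract_right K D C (counit C)) id"
  note hom = module_hom_comp[OF module_hom_comp[OF
      tensor_map(1)[OF mD mC mD mCC module_hom_id C.comul_linear] tensor_unassoc(1)[OF mD mC mC]] E(1)]
  show ?thesis
  proof (rule tensor_hom_eqI[OF mD mC mDC hom hom_ident _ X])
    fix d c assume dc: "d \<in> carrier D" "c \<in> carrier C"
    have "?E (tensor_unassoc K D C C (tensor_map K D C D (tensor K C C) id (comul C) (dc d c))) =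
        sweedler K C (tensor K D C) (\<lambda>p q. counit C p \<odot>\<^bsub>tensor K D C\<^esub> dc d q) c"
      unfolding comul_right_expand[OF mDC E(1) dc]
      by (rule fun_cong[OF sweedler_cong])
        (use dc in \<open>simp add: E(2) cr(2) pure_tensor_closed[OF mD mC] C.counit_closed
           module_hom_smult[OF pure_tensor_hom(2)[OF mD mC]]\<close>)
    also have "\<dots> = dc d c"
      by (rule C.sweedler_counit_left[OF mDC pure_tensor_hom(1)[OF mD mC dc(1)] dc(2)])
    finally show "?E (tensor_unassoc K D C C (tensor_map K D C D (tensor K C C) id (comul C) (dc d c))) = dc d c" .
  qed
qed

text \<open>Left colinearity and the counit of \<open>D\<close> give
  \<open>\<Psi>'(d \<otimes> c) = d\<^sub>1 \<otimes> (\<epsilon>\<^sub>D \<otimes> id)\<Psi>'(d\<^sub>2 \<otimes> c)\<close>; right colinearity and the counit of \<open>C\<close> give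
  \<open>\<Psi>'(d \<otimes> c) = (id \<otimes> \<epsilon>\<^sub>C)\<Psi>'(d \<otimes> c\<^sub>1) \<otimes> c\<^sub>2\<close>, which is inserted into the first.\<close>

lemma Tw_expand:
  assumes Tw: "\<Psi>' \<in> Tw K C D" and d: "d \<in> carrier D" and c: "c \<in> carrier C"
  shows "\<Psi>' (dc d c) = sweedler K C (tensor K D C) (\<lambda>p q. sweedler K D (tensor K D C) (\<lambda>r s.
    tensor_functional K D C (counit D) (counit C) (\<Psi>' (dc s p)) \<odot>\<^bsub>tensor K D C\<^esub> dc r q) d) c"
proof -
  note mC = C.module_axioms and mD = D.module_axioms
  note mDC = tensor_module[OF mD mC]
  have \<Psi>': "\<Psi>' \<in> module_hom K (tensor K D C) (tensor K D C)" using Tw by (simp add: Tw_def)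
  let ?cl = "contract_left K D C (counit D)" and ?cr = "contract_right K D C (counit C)"
  let ?\<phi> = "tensor_functional K D C (counit D) (counit C)"
  note cl = contract_left[OF mD mC D.counit_linear]
  note cr = contract_right[OF mD mC C.counit_linear]
  note tf = tensor_functional_props[OF mD mC D.counit_linear C.counit_linear]
  note map\<Psi>D = tensor_map[OF mD mDC mD mDC module_hom_id \<Psi>']
  note map\<Psi>C = tensor_map[OF mDC mC mDC mC \<Psi>' module_hom_id]
  note mapcl = tensor_map[OF mD mDC mD mC module_hom_id cl(1)]
  note mapcr = tensor_map[OF mDC mC mD mC cr(1) module_hom_id]
  note closed = hom_closed[OF \<Psi>'] hom_closed[OF cl(1)] hom_closed[OF cr(1)]
    pure_tensor_closed[OF mD mC] hom_closed[OF tf(1), simplified]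
  note lin = linear_intros module_hom_comp[OF _ \<Psi>'] module_hom_comp[OF _ cr(1)]
    module_hom_comp[OF _ tf(1)]
  have left: "\<Psi>' (dc d c) = sweedler K D (tensor K D C) (\<lambda>r s. dc r (?cl (\<Psi>' (dc s c)))) d"
    if d: "d \<in> carrier D" and c: "c \<in> carrier C" for d c
  proof -
    note dcc = closed(4)[OF d c]
    have "\<Psi>' (dc d c) = tensor_map K D (tensor K D C) D C id ?cl
      (tensor_map K D (tensor K D C) D (tensor K D C) id \<Psi>'
        (tensor_assoc K D D C (tensor_map K D C (tensor K D D) C (comul D) id (dc d c))))"
      using counit_comul_left[OF closed(1)[OF dcc]] Tw dcc by (simp add: Tw_def)
    also have "\<dots> = sweedler K D (tensor K D C) (\<lambda>r s. dc r (?cl (\<Psi>' (dc s c)))) d"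
      unfolding comul_left_expand[OF mDC module_hom_comp[OF map\<Psi>D(1) mapcl(1)] d c]
      by (rule fun_cong[OF sweedler_cong]) (simp add: map\<Psi>D(2) mapcl(2) closed c)
    finally show ?thesis .
  qed
  have right: "\<Psi>' (dc d c) = sweedler K C (tensor K D C) (\<lambda>p q. dc (?cr (\<Psi>' (dc d p))) q) c"
    if d: "d \<in> carrier D" and c: "c \<in> carrier C" for d c
  proof -
    note dcc = closed(4)[OF d c]
    have "\<Psi>' (dc d c) = tensor_map K (tensor K D C) C D C ?cr id
      (tensor_map K (tensor K D C) C (tensor K D C) C \<Psi>' id
        (tensor_unassoc K D C C (tensor_map K D C D (tensor K C C) id (comul C) (dc d c))))"
      using counit_comul_right[OF closed(1)[OF dcc]] Tw dcc by (simp add: Tw_def)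
    also have "\<dots> = sweedler K C (tensor K D C) (\<lambda>p q. dc (?cr (\<Psi>' (dc d p))) q) c"
      unfolding comul_right_expand[OF mDC module_hom_comp[OF map\<Psi>C(1) mapcr(1)] d c]
      by (rule fun_cong[OF sweedler_cong]) (simp add: map\<Psi>C(2) mapcr(2) closed d)
    finally show ?thesis .
  qed
  have both: "dc r (?cl (\<Psi>' (dc s c))) =
      sweedler K C (tensor K D C) (\<lambda>p q. ?\<phi> (\<Psi>' (dc s p)) \<odot>\<^bsub>tensor K D C\<^esub> dc r q) c"
    if r: "r \<in> carrier D" and s: "s \<in> carrier D" for r s
  proof -
    note g = module_hom_comp[OF cl(1) pure_tensor_hom(1)[OF mD mC r]]
    have "dc r (?cl (\<Psi>' (dc s c))) =
        dc r (?cl (sweedler K C (tensor K D C) (\<lambda>p q. dc (?cr (\<Psi>' (dc s p))) q) c))"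
      by (simp add: right[OF s c])
    also have "\<dots> = sweedler K C (tensor K D C) (\<lambda>p q. dc r (?cl (dc (?cr (\<Psi>' (dc s p))) q))) c"
      by (rule C.hom_sweedler[OF mDC mDC g _ c]) (intro lin closed s; assumption)
    also have "\<dots> = sweedler K C (tensor K D C) (\<lambda>p q. ?\<phi> (\<Psi>' (dc s p)) \<odot>\<^bsub>tensor K D C\<^esub> dc r q) c"
      by (rule fun_cong[OF sweedler_cong])
        (simp add: cl(2) closed s r tf(4) D.counit_closed module_hom_smult[OF pure_tensor_hom(1)[OF mD mC r]])
    finally show ?thesis .
  qed
  have "\<Psi>' (dc d c) = sweedler K D (tensor K D C) (\<lambda>r s. sweedler K C (tensor K D C) (\<lambda>p q.
      ?\<phi> (\<Psi>' (dc s p)) \<odot>\<^bsub>tensor K D C\<^esub> dc r q) c) d"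
    by (simp add: left[OF d c] both cong: sweedler_cong)
  also have "\<dots> = sweedler K C (tensor K D C) (\<lambda>p q. sweedler K D (tensor K D C) (\<lambda>r s.
      ?\<phi> (\<Psi>' (dc s p)) \<odot>\<^bsub>tensor K D C\<^esub> dc r q) d) c"
    by (rule D.sweedler_commute[OF C.coalgebra_axioms mDC _ _ d c])
      (intro lin closed; assumption)+
  finally show ?thesis .
qed


section \<open>The tensor product coalgebra\<close>

abbreviation "\<Delta>\<^sub>\<tau> \<equiv> twisted_comul K C D (tensor_flip K C D)"
abbreviation "counit_CD \<equiv> tensor_functional K C D (counit C) (counit D)"

lemma convolution_linear:
  assumes "\<alpha> \<in> module_hom K CD (ground_vs K)" "\<beta> \<in> module_hom K CD (ground_vs K)"
  shows "convolution K C D \<alpha> \<beta> \<in> module_hom K CD (ground_vs K)"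
  unfolding convolution_def comp_def
  by (rule module_hom_comp[OF twisted_comul_linear tensor_functional_props(1)])
    (intro modules tensor_flip assms)+

lemma flip_counit:
  assumes x: "x \<in> carrier CD"
  shows "contract_left K CD CD counit_CD (\<Delta>\<^sub>\<tau> x) = x"
    and "contract_right K CD CD counit_CD (\<Delta>\<^sub>\<tau> x) = x"
proof -
  note mC = C.module_axioms and mD = D.module_axioms
  note mCD = tensor_module[OF mC mD]
  interpret CD: module K CD by (rule mCD)
  note e = tensor_functional_props[OF mC mD C.counit_linear D.counit_linear]
  note cl = contract_left[OF mCD mCD e(1)] and cr = contract_right[OF mCD mCD e(1)]
  note \<Delta> = twisted_comul_linear[OF tensor_flip(1)[OF mC mD]]
  note closed = pure_tensor_closed[OF mC mD] C.counit_closed D.counit_closed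
    hom_closed[OF e(1), simplified]
  note lin = pure_tensor_hom[OF mC mD]
  show "contract_left K CD CD counit_CD (\<Delta>\<^sub>\<tau> x) = x"
  proof (rule tensor_hom_eqI[OF mC mD mCD module_hom_comp[OF \<Delta> cl(1)] hom_ident _ x])
    fix c d assume cd: "c \<in> carrier C" "d \<in> carrier D"
    have "contract_left K CD CD counit_CD (\<Delta>\<^sub>\<tau> (cd c d)) =
      sweedler K C CD (\<lambda>a q. counit C a \<odot>\<^bsub>CD\<^esub>
        sweedler K D CD (\<lambda>r b. counit D r \<odot>\<^bsub>CD\<^esub> cd q b) d) c"
      unfolding flip_comul_expand[OF mCD cl(1) cd]
    proof (rule fun_cong[OF sweedler_cong])
      fix a q assume aq: "a \<in> carrier C" "q \<in> carrier C"
      note s = module_hom_smultI[OF mCD hom_ident C.counit_closed[OF aq(1)]]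
      show "sweedler K D CD (\<lambda>r b. contract_left K CD CD counit_CD (cdcd a r q b)) d =
          counit C a \<odot>\<^bsub>CD\<^esub> sweedler K D CD (\<lambda>r b. counit D r \<odot>\<^bsub>CD\<^esub> cd q b) d"
        by (subst D.hom_sweedler[OF mCD mCD s _ cd(2)])
          (use aq in \<open>auto intro!: bilinear_mapI hom_smult_left D.counit_linear mCD module_hom_smultI lin
             simp: cl(2) e(2) closed CD.smult_assoc1 cong: sweedler_cong\<close>)
    qed
    also have "\<dots> = sweedler K C CD (\<lambda>a q. counit C a \<odot>\<^bsub>CD\<^esub> cd q d) c"
      by (rule fun_cong[OF sweedler_cong]) (simp add: D.sweedler_counit_left[OF mCD lin(1) cd(2)])
    also have "\<dots> = cd c d" by (rule C.sweedler_counit_left[OF mCD lin(2)[OF cd(2)] cd(1)])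
    finally show "contract_left K CD CD counit_CD (\<Delta>\<^sub>\<tau> (cd c d)) = cd c d" .
  qed
  show "contract_right K CD CD counit_CD (\<Delta>\<^sub>\<tau> x) = x"
  proof (rule tensor_hom_eqI[OF mC mD mCD module_hom_comp[OF \<Delta> cr(1)] hom_ident _ x])
    fix c d assume cd: "c \<in> carrier C" "d \<in> carrier D"
    have "contract_right K CD CD counit_CD (\<Delta>\<^sub>\<tau> (cd c d)) =
      sweedler K C CD (\<lambda>a q. counit C q \<odot>\<^bsub>CD\<^esub>
        sweedler K D CD (\<lambda>r b. counit D b \<odot>\<^bsub>CD\<^esub> cd a r) d) c"
      unfolding flip_comul_expand[OF mCD cr(1) cd]
    proof (rule fun_cong[OF sweedler_cong])
      fix a q assume aq: "a \<in> carrier C" "q \<in> carrier C"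
      note s = module_hom_smultI[OF mCD hom_ident C.counit_closed[OF aq(2)]]
      show "sweedler K D CD (\<lambda>r b. contract_right K CD CD counit_CD (cdcd a r q b)) d =
          counit C q \<odot>\<^bsub>CD\<^esub> sweedler K D CD (\<lambda>r b. counit D b \<odot>\<^bsub>CD\<^esub> cd a r) d"
        by (subst D.hom_sweedler[OF mCD mCD s _ cd(2)])
          (use aq in \<open>auto intro!: bilinear_mapI hom_smult_left D.counit_linear mCD module_hom_smultI lin
             simp: cr(2) e(2) closed CD.smult_assoc1 cong: sweedler_cong\<close>)
    qed
    also have "\<dots> = sweedler K C CD (\<lambda>a q. counit C q \<odot>\<^bsub>CD\<^esub> cd a d) c"
      by (rule fun_cong[OF sweedler_cong]) (simp add: D.sweedler_counit_right[OF mCD lin(1) cd(2)])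
    also have "\<dots> = cd c d" by (rule C.sweedler_counit_right[OF mCD lin(2)[OF cd(2)] cd(1)])
    finally show "contract_right K CD CD counit_CD (\<Delta>\<^sub>\<tau> (cd c d)) = cd c d" .
  qed
qed


section \<open>Counits of the twisted coproduct\<close>

lemma Tw_linear:
  assumes Tw: "\<Psi>' \<in> Tw K C D" and \<Psi>: "\<Psi> = \<Psi>' \<circ> tensor_flip K C D"
    and \<phi>: "\<phi> = tensor_functional K D C (counit D) (counit C) \<circ> \<Psi>"
  shows "\<Psi> \<in> module_hom K CD (tensor K D C)" and "\<phi> \<in> module_hom K CD (ground_vs K)"
proof -
  note mC = C.module_axioms and mD = D.module_axioms
  have \<Psi>': "\<Psi>' \<in> module_hom K (tensor K D C) (tensor K D C)" using Tw by (simp add: Tw_def)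
  show \<Psi>hom: "\<Psi> \<in> module_hom K CD (tensor K D C)"
    unfolding \<Psi> comp_def by (rule module_hom_comp[OF tensor_flip(1)[OF mC mD] \<Psi>'])
  show "\<phi> \<in> module_hom K CD (ground_vs K)"
    unfolding \<phi> comp_def
    by (rule module_hom_comp[OF \<Psi>hom
          tensor_functional_props(1)[OF mD mC D.counit_linear C.counit_linear]])
qed

text \<open>Inserting the formula for \<open>\<Psi>(c\<^sub>2 \<otimes> d\<^sub>1)\<close> into \<open>c\<^sub>1 \<otimes> \<Psi>(c\<^sub>2 \<otimes> d\<^sub>1) \<otimes> d\<^sub>2\<close> produces
  \<open>\<phi>(c\<^sub>2 \<otimes> d\<^sub>2) (c\<^sub>1 \<otimes> d\<^sub>1) \<otimes> (c\<^sub>3 \<otimes> d\<^sub>3)\<close>, with threefold coproducts read as \<open>c\<^sub>1 \<otimes> \<Delta>(c\<^sub>2)\<close> and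
  \<open>\<Delta>(d\<^sub>1) \<otimes> d\<^sub>2\<close>. The \<open>C\<close>-part stands outside the \<open>D\<close>-part so that coassociativity applies to each of them.\<close>

lemma twisted_comul_Tw_expand:
  assumes Tw: "\<Psi>' \<in> Tw K C D" and \<Psi>: "\<Psi> = \<Psi>' \<circ> tensor_flip K C D"
    and \<phi>: "\<phi> = tensor_functional K D C (counit D) (counit C) \<circ> \<Psi>"
    and P: "module K P" and h: "h \<in> module_hom K (tensor K CD CD) P"
    and c: "c \<in> carrier C" and d: "d \<in> carrier D"
  shows "h (twisted_comul K C D \<Psi> (cd c d)) =
    sweedler K C P (\<lambda>a c'. sweedler K C P (\<lambda>p q. sweedler K D P (\<lambda>d' b. sweedler K D P (\<lambda>r s.
      \<phi> (cd p s) \<odot>\<^bsub>P\<^esub> h (cdcd a r q b)) d') d) c') c"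
proof -
  note mC = C.module_axioms and mD = D.module_axioms
  note mDC = tensor_module[OF mD mC] and mCD = tensor_module[OF mC mD]
  note \<Psi>hom = Tw_linear(1)[OF Tw \<Psi> \<phi>] and \<phi>hom = Tw_linear(2)[OF Tw \<Psi> \<phi>]
  note closed = hom_closed[OF \<phi>hom, simplified] hom_closed[OF h]
  note lin = linear_intros module_hom_comp[OF _ \<phi>hom] module_hom_comp[OF _ h]
  \<comment> \<open>What happens to the middle factor \<open>Z \<in> D \<otimes> C\<close> of \<open>a \<otimes> Z \<otimes> b\<close> after regrouping.\<close>
  define N where "N a b Z = h (tensor_unassoc K C D CD (pure_tensor K C (tensor K D CD) a
      (tensor_assoc K D C D (pure_tensor K (tensor K D C) D Z b))))" for a b Z
  have N: "N a b \<in> module_hom K (tensor K D C) P" if "a \<in> carrier C" "b \<in> carrier D" for a b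
    unfolding N_def
    by (rule module_hom_comp[OF module_hom_comp[OF hom_pure_tensor_right[OF _ _ module_hom_comp[OF
              hom_pure_tensor_left[OF _ _ hom_ident] tensor_assoc(1)]] tensor_unassoc(1)] h])
      (intro modules that)+
  have Npure: "N a b (dc r q) = h (cdcd a r q b)"
    if "a \<in> carrier C" "b \<in> carrier D" "r \<in> carrier D" "q \<in> carrier C" for a b r q
    using that by (simp add: N_def tensor_assoc(2) tensor_unassoc(2) modules pure_tensor_closed)
  have \<Psi>pure: "\<Psi> (cd c' d') = sweedler K C (tensor K D C) (\<lambda>p q. sweedler K D (tensor K D C) (\<lambda>r s.
      \<phi> (cd p s) \<odot>\<^bsub>tensor K D C\<^esub> dc r q) d') c'"
    if "c' \<in> carrier C" "d' \<in> carrier D" for c' d'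
    using that Tw_expand[OF Tw that(2,1)]
    by (simp add: \<phi> \<Psi> tensor_flip(2)[OF mC mD] cong: sweedler_cong)
  have N\<Psi>: "N a b (\<Psi> (cd c' d')) = sweedler K C P (\<lambda>p q. sweedler K D P (\<lambda>r s.
      \<phi> (cd p s) \<odot>\<^bsub>P\<^esub> h (cdcd a r q b)) d') c'"
    if m: "a \<in> carrier C" "b \<in> carrier D" "c' \<in> carrier C" "d' \<in> carrier D" for a b c' d'
  proof -
    note Nab = N[OF m(1,2)]
    have "N a b (\<Psi> (cd c' d')) = sweedler K C P (\<lambda>p q. N a b (sweedler K D (tensor K D C) (\<lambda>r s.
      \<phi> (cd p s) \<odot>\<^bsub>tensor K D C\<^esub> dc r q) d')) c'"
      unfolding \<Psi>pure[OF m(3,4)]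
      by (rule C.hom_sweedler[OF mDC P Nab _ m(3)]) (intro lin closed m; assumption)
    also have "\<dots> = sweedler K C P (\<lambda>p q. sweedler K D P (\<lambda>r s.
      \<phi> (cd p s) \<odot>\<^bsub>P\<^esub> h (cdcd a r q b)) d') c'"
    proof (rule fun_cong[OF sweedler_cong])
      fix p q assume pq: "p \<in> carrier C" "q \<in> carrier C"
      have "N a b (sweedler K D (tensor K D C) (\<lambda>r s. \<phi> (cd p s) \<odot>\<^bsub>tensor K D C\<^esub> dc r q) d') =
          sweedler K D P (\<lambda>r s. N a b (\<phi> (cd p s) \<odot>\<^bsub>tensor K D C\<^esub> dc r q)) d'"
        by (rule D.hom_sweedler[OF mDC P Nab _ m(4)]) (intro lin closed m pq; assumption)
      then show "N a b (sweedler K D (tensor K D C) (\<lambda>r s. \<phi> (cd p s) \<odot>\<^bsub>tensor K D C\<^esub> dc r q) d') =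
          sweedler K D P (\<lambda>r s. \<phi> (cd p s) \<odot>\<^bsub>P\<^esub> h (cdcd a r q b)) d'"
        using m pq by (simp add: module_hom_smult[OF Nab] Npure closed pure_tensor_closed mC mD
            cong: sweedler_cong)
    qed
    finally show ?thesis .
  qed
  have "h (twisted_comul K C D \<Psi> (cd c d)) =
      sweedler K C P (\<lambda>a c'. sweedler K D P (\<lambda>d' b. sweedler K C P (\<lambda>p q. sweedler K D P (\<lambda>r s.
      \<phi> (cd p s) \<odot>\<^bsub>P\<^esub> h (cdcd a r q b)) d') c') d) c"
    unfolding twisted_comul_expand[OF \<Psi>hom P h c d] N_def[symmetric]
    by (simp add: N\<Psi> cong: sweedler_cong)
  also have "\<dots> = sweedler K C P (\<lambda>a c'. sweedler K C P (\<lambda>p q. sweedler K D P (\<lambda>d' b. sweedler K D P (\<lambda>r s.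
      \<phi> (cd p s) \<odot>\<^bsub>P\<^esub> h (cdcd a r q b)) d') d) c') c"
    by (rule fun_cong[OF sweedler_cong], rule D.sweedler_commute[OF C.coalgebra_axioms P _ _ d])
      (intro lin closed P; assumption)+
  finally show ?thesis .
qed

text \<open>With the vector \<open>X\<close> pushed inside, a convolution can be recognised as a coefficient within a
  nested Sweedler expression with values in \<open>P\<close>.\<close>

lemma convolution_pure_smult:
  assumes \<alpha>: "\<alpha> \<in> module_hom K CD (ground_vs K)" and \<beta>: "\<beta> \<in> module_hom K CD (ground_vs K)"
    and P: "module K P" and X: "X \<in> carrier P"
    and w: "w \<in> carrier C" and u: "u \<in> carrier D"
  shows "convolution K C D \<alpha> \<beta> (cd w u) \<odot>\<^bsub>P\<^esub> X =
    sweedler K C P (\<lambda>p q. sweedler K D P (\<lambda>r s. \<alpha> (cd p r) \<odot>\<^bsub>P\<^esub> (\<beta> (cd q s) \<odot>\<^bsub>P\<^esub> X)) u) w"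
proof -
  note mC = C.module_axioms and mD = D.module_axioms
  note mCD = tensor_module[OF mC mD] and mK = ground_vs_module[OF C.R.is_cring]
  interpret P: module K P by (rule P)
  note tf = tensor_functional_props[OF mCD mCD \<alpha> \<beta>]
  note closed = hom_closed[OF \<alpha>, simplified] hom_closed[OF \<beta>, simplified]
    hom_closed[OF tf(1), simplified]
  note lin = linear_intros module_hom_comp[OF _ \<alpha>] module_hom_comp[OF _ \<beta>]
    module_hom_comp[OF _ tf(1)]
  note g = hom_smult_left[OF P hom_ident X]
  have "convolution K C D \<alpha> \<beta> (cd w u) \<odot>\<^bsub>P\<^esub> X = sweedler K C (ground_vs K) (\<lambda>p q.
      sweedler K D (ground_vs K) (\<lambda>r s. tensor_functional K CD CD \<alpha> \<beta> (cdcd p r q s)) u) w \<odot>\<^bsub>P\<^esub> X"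
    by (simp add: convolution_def flip_comul_expand[OF mK tf(1) w u])
  also have "\<dots> = sweedler K C P (\<lambda>p q. sweedler K D (ground_vs K)
      (\<lambda>r s. tensor_functional K CD CD \<alpha> \<beta> (cdcd p r q s)) u \<odot>\<^bsub>P\<^esub> X) w"
    by (rule C.hom_sweedler[OF mK P g _ w]) (intro lin closed u; assumption)
  also have "\<dots> = sweedler K C P (\<lambda>p q. sweedler K D P
      (\<lambda>r s. \<alpha> (cd p r) \<odot>\<^bsub>P\<^esub> (\<beta> (cd q s) \<odot>\<^bsub>P\<^esub> X)) u) w"
  proof (rule fun_cong[OF sweedler_cong])
    fix p q assume pq: "p \<in> carrier C" "q \<in> carrier C"
    have "sweedler K D (ground_vs K) (\<lambda>r s. tensor_functional K CD CD \<alpha> \<beta> (cdcd p r q s)) u \<odot>\<^bsub>P\<^esub> X =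
        sweedler K D P (\<lambda>r s. tensor_functional K CD CD \<alpha> \<beta> (cdcd p r q s) \<odot>\<^bsub>P\<^esub> X) u"
      by (rule D.hom_sweedler[OF mK P g _ u]) (intro lin closed pq; assumption)
    then show "sweedler K D (ground_vs K) (\<lambda>r s. tensor_functional K CD CD \<alpha> \<beta> (cdcd p r q s)) u \<odot>\<^bsub>P\<^esub> X =
        sweedler K D P (\<lambda>r s. \<alpha> (cd p r) \<odot>\<^bsub>P\<^esub> (\<beta> (cd q s) \<odot>\<^bsub>P\<^esub> X)) u"
      using pq X by (simp add: tf(2) closed pure_tensor_closed[OF mC mD] P.smult_assoc1
          cong: sweedler_cong)
  qed
  finally show ?thesis .
qed

text \<open>Both identities compare two readings of the threefold coproducts. On the left,
  \<open>\<epsilon>(c\<^sub>1 \<otimes> d\<^sub>1) \<phi>(c\<^sub>2 \<otimes> d\<^sub>2)\<close> becomes \<open>\<epsilon> * \<phi>\<close> once \<open>c\<^sub>1 \<otimes> c\<^sub>2\<close> and \<open>d\<^sub>1 \<otimes> d\<^sub>2\<close> are both single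
  coproducts. For \<open>d\<close> this is the case already, and coassociativity of \<open>C\<close> makes it so for \<open>c\<close>; on the
  right the roles of \<open>C\<close> and \<open>D\<close> are exchanged.\<close>

lemma contract_twisted_comul:
  assumes Tw: "\<Psi>' \<in> Tw K C D" and \<Psi>: "\<Psi> = \<Psi>' \<circ> tensor_flip K C D"
    and \<phi>: "\<phi> = tensor_functional K D C (counit D) (counit C) \<circ> \<Psi>"
    and \<epsilon>: "\<epsilon> \<in> module_hom K CD (ground_vs K)" and x: "x \<in> carrier CD"
  shows "contract_left K CD CD \<epsilon> (twisted_comul K C D \<Psi> x) =
      contract_left K CD CD (convolution K C D \<epsilon> \<phi>) (\<Delta>\<^sub>\<tau> x)"
    and "contract_right K CD CD \<epsilon> (twisted_comul K C D \<Psi> x) =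
      contract_right K CD CD (convolution K C D \<phi> \<epsilon>) (\<Delta>\<^sub>\<tau> x)"
proof -
  note mC = C.module_axioms and mD = D.module_axioms
  note mDC = tensor_module[OF mD mC] and mCD = tensor_module[OF mC mD]
  interpret CD: module K CD by (rule mCD)
  note \<Psi>hom = Tw_linear(1)[OF Tw \<Psi> \<phi>] and \<phi>hom = Tw_linear(2)[OF Tw \<Psi> \<phi>]
  note \<Delta>\<Psi> = twisted_comul_linear[OF \<Psi>hom] and \<Delta>\<tau> = twisted_comul_linear[OF tensor_flip(1)[OF mC mD]]
  note expand = twisted_comul_Tw_expand[OF Tw \<Psi> \<phi> mCD]
  note conv = convolution_linear[OF \<epsilon> \<phi>hom] convolution_linear[OF \<phi>hom \<epsilon>]
  note cl = contract_left[OF mCD mCD \<epsilon>] and cr = contract_right[OF mCD mCD \<epsilon>]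
  note cl' = contract_left[OF mCD mCD conv(1)] and cr' = contract_right[OF mCD mCD conv(2)]
  note closed = hom_closed[OF \<phi>hom, simplified] hom_closed[OF \<epsilon>, simplified]
    hom_closed[OF cl(1)] hom_closed[OF cr(1)]
  note lin = linear_intros module_hom_comp[OF _ \<phi>hom] module_hom_comp[OF _ \<epsilon>]
    module_hom_comp[OF _ cl(1)] module_hom_comp[OF _ cr(1)]
  let ?swC = "sweedler K C CD" and ?swD = "sweedler K D CD"
  show "contract_left K CD CD \<epsilon> (twisted_comul K C D \<Psi> x) =
      contract_left K CD CD (convolution K C D \<epsilon> \<phi>) (\<Delta>\<^sub>\<tau> x)"
  proof (rule tensor_hom_eqI[OF mC mD mCD module_hom_comp[OF \<Delta>\<Psi> cl(1)] module_hom_comp[OF \<Delta>\<tau> cl'(1)] _ x])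
    fix c d assume c: "c \<in> carrier C" and d: "d \<in> carrier D"
    let ?h = "contract_left K CD CD \<epsilon>"
    have "?h (twisted_comul K C D \<Psi> (cd c d)) = ?swC (\<lambda>a w. ?swC (\<lambda>p q. ?swD (\<lambda>d' b. ?swD (\<lambda>r s.
        \<phi> (cd p s) \<odot>\<^bsub>CD\<^esub> ?h (cdcd a r q b)) d') d) w) c"
      by (rule expand[OF cl(1) c d])
    also have "\<dots> = ?swC (\<lambda>w q. ?swC (\<lambda>a p. ?swD (\<lambda>d' b. ?swD (\<lambda>r s.
        \<phi> (cd p s) \<odot>\<^bsub>CD\<^esub> ?h (cdcd a r q b)) d') d) w) c"
      by (rule C.sweedler_coassoc[OF mCD _ _ _ c, symmetric]) (intro lin closed c d; assumption)+
    also have "\<dots> = ?swC (\<lambda>w q. ?swD (\<lambda>d' b. ?swC (\<lambda>a p. ?swD (\<lambda>r s.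
        \<phi> (cd p s) \<odot>\<^bsub>CD\<^esub> ?h (cdcd a r q b)) d') w) d) c"
      by (rule fun_cong[OF sweedler_cong], rule C.sweedler_commute[OF D.coalgebra_axioms mCD _ _ _ d])
        (intro lin closed; assumption)+
    also have "\<dots> = ?swC (\<lambda>w q. ?swD (\<lambda>d' b. ?swC (\<lambda>a p. ?swD (\<lambda>r s.
        \<epsilon> (cd a r) \<odot>\<^bsub>CD\<^esub> (\<phi> (cd p s) \<odot>\<^bsub>CD\<^esub> cd q b)) d') w) d) c"
      by (simp add: cl(2) closed pure_tensor_closed[OF mC mD] C.R.m_comm
          CD.smult_assoc1[symmetric] cong: sweedler_cong)
    also have "\<dots> = ?swC (\<lambda>w q. ?swD (\<lambda>d' b.
        contract_left K CD CD (convolution K C D \<epsilon> \<phi>) (cdcd w d' q b)) d) c"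
      by (simp add: convolution_pure_smult[OF \<epsilon> \<phi>hom mCD] cl'(2) pure_tensor_closed[OF mC mD]
          cong: sweedler_cong)
    also have "\<dots> = contract_left K CD CD (convolution K C D \<epsilon> \<phi>) (\<Delta>\<^sub>\<tau> (cd c d))"
      by (rule flip_comul_expand[OF mCD cl'(1) c d, symmetric])
    finally show "?h (twisted_comul K C D \<Psi> (cd c d)) =
        contract_left K CD CD (convolution K C D \<epsilon> \<phi>) (\<Delta>\<^sub>\<tau> (cd c d))" .
  qed
  show "contract_right K CD CD \<epsilon> (twisted_comul K C D \<Psi> x) =
      contract_right K CD CD (convolution K C D \<phi> \<epsilon>) (\<Delta>\<^sub>\<tau> x)"
  proof (rule tensor_hom_eqI[OF mC mD mCD module_hom_comp[OF \<Delta>\<Psi> cr(1)] module_hom_comp[OF \<Delta>\<tau> cr'(1)] _ x])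
    fix c d assume c: "c \<in> carrier C" and d: "d \<in> carrier D"
    let ?h = "contract_right K CD CD \<epsilon>"
    have "?h (twisted_comul K C D \<Psi> (cd c d)) = ?swC (\<lambda>a w. ?swC (\<lambda>p q. ?swD (\<lambda>u b. ?swD (\<lambda>r s.
        \<phi> (cd p s) \<odot>\<^bsub>CD\<^esub> ?h (cdcd a r q b)) u) d) w) c"
      by (rule expand[OF cr(1) c d])
    also have "\<dots> = ?swC (\<lambda>a w. ?swC (\<lambda>p q. ?swD (\<lambda>r u. ?swD (\<lambda>s b.
        \<phi> (cd p s) \<odot>\<^bsub>CD\<^esub> ?h (cdcd a r q b)) u) d) w) c"
      by (rule fun_cong[OF sweedler_cong], rule fun_cong[OF sweedler_cong],
          rule D.sweedler_coassoc[OF mCD _ _ _ d]) (intro lin closed; assumption)+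
    also have "\<dots> = ?swC (\<lambda>a w. ?swD (\<lambda>r u. ?swC (\<lambda>p q. ?swD (\<lambda>s b.
        \<phi> (cd p s) \<odot>\<^bsub>CD\<^esub> ?h (cdcd a r q b)) u) w) d) c"
      by (rule fun_cong[OF sweedler_cong], rule C.sweedler_commute[OF D.coalgebra_axioms mCD _ _ _ d])
        (intro lin closed; assumption)+
    also have "\<dots> = ?swC (\<lambda>a w. ?swD (\<lambda>r u.
        contract_right K CD CD (convolution K C D \<phi> \<epsilon>) (cdcd a r w u)) d) c"
      by (simp add: convolution_pure_smult[OF \<phi>hom \<epsilon> mCD] cr(2) cr'(2) pure_tensor_closed[OF mC mD]
          cong: sweedler_cong)
    also have "\<dots> = contract_right K CD CD (convolution K C D \<phi> \<epsilon>) (\<Delta>\<^sub>\<tau> (cd c d))"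
      by (rule flip_comul_expand[OF mCD cr'(1) c d, symmetric])
    finally show "?h (twisted_comul K C D \<Psi> (cd c d)) =
        contract_right K CD CD (convolution K C D \<phi> \<epsilon>) (\<Delta>\<^sub>\<tau> (cd c d))" .
  qed
qed

text \<open>The counit of \<open>\<Delta>\<^sub>\<tau>\<close> on the other side recovers \<open>\<alpha>\<close>:
  \<open>\<alpha> = (\<alpha> \<otimes> (\<epsilon>\<^sub>C \<otimes> \<epsilon>\<^sub>D))\<Delta>\<^sub>\<tau> = (\<epsilon>\<^sub>C \<otimes> \<epsilon>\<^sub>D)(\<alpha> \<otimes> id)\<Delta>\<^sub>\<tau>\<close>, and symmetrically.\<close>

lemma contract_flip_eq_iff:
  assumes \<alpha>: "\<alpha> \<in> module_hom K CD (ground_vs K)"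
  shows "(\<forall>x\<in>carrier CD. contract_left K CD CD \<alpha> (\<Delta>\<^sub>\<tau> x) = x) \<longleftrightarrow> (\<forall>x\<in>carrier CD. \<alpha> x = counit_CD x)"
    and "(\<forall>x\<in>carrier CD. contract_right K CD CD \<alpha> (\<Delta>\<^sub>\<tau> x) = x) \<longleftrightarrow> (\<forall>x\<in>carrier CD. \<alpha> x = counit_CD x)"
proof -
  note mC = C.module_axioms and mD = D.module_axioms
  note mCD = tensor_module[OF mC mD]
  note e = tensor_functional_props(1)[OF mC mD C.counit_linear D.counit_linear]
  note \<Delta> = hom_closed[OF twisted_comul_linear[OF tensor_flip(1)[OF mC mD]]]
  have cong: "contract_left K CD CD \<alpha> = contract_left K CD CD counit_CD"
    "contract_right K CD CD \<alpha> = contract_right K CD CD counit_CD"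
    if "\<forall>x\<in>carrier CD. \<alpha> x = counit_CD x"
    using that by (simp_all add: contract_left_def contract_right_def cong: tensor_lift_cong)
  have "\<alpha> x = counit_CD (contract_left K CD CD \<alpha> (\<Delta>\<^sub>\<tau> x))"
    "\<alpha> x = counit_CD (contract_right K CD CD \<alpha> (\<Delta>\<^sub>\<tau> x))" if x: "x \<in> carrier CD" for x
    using tensor_functional_props(3,4)[OF mCD mCD \<alpha> e \<Delta>[OF x]]
      tensor_functional_props(3,4)[OF mCD mCD e \<alpha> \<Delta>[OF x]] flip_counit[OF x] by simp_all
  then show "(\<forall>x\<in>carrier CD. contract_left K CD CD \<alpha> (\<Delta>\<^sub>\<tau> x) = x) \<longleftrightarrow> (\<forall>x\<in>carrier CD. \<alpha> x = counit_CD x)"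
    and "(\<forall>x\<in>carrier CD. contract_right K CD CD \<alpha> (\<Delta>\<^sub>\<tau> x) = x) \<longleftrightarrow> (\<forall>x\<in>carrier CD. \<alpha> x = counit_CD x)"
    using cong flip_counit by metis+
qed

lemma twisted_counit_iff_convolution_inverse:
  assumes Tw: "\<Psi>' \<in> Tw K C D" and \<Psi>: "\<Psi> = \<Psi>' \<circ> tensor_flip K C D"
    and \<phi>: "\<phi> = tensor_functional K D C (counit D) (counit C) \<circ> \<Psi>"
  shows "twisted_counit K C D \<Psi> \<epsilon> \<longleftrightarrow> convolution_inverse K C D \<phi> \<epsilon>"
proof (cases "\<epsilon> \<in> module_hom K CD (ground_vs K)")
  case True
  note \<phi>hom = Tw_linear(2)[OF Tw \<Psi> \<phi>]
  note contract_flip_eq_iff(1)[OF convolution_linear[OF True \<phi>hom]]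
    contract_flip_eq_iff(2)[OF convolution_linear[OF \<phi>hom True]]
  then show ?thesis
    using True contract_twisted_comul[OF Tw \<Psi> \<phi> True]
    unfolding twisted_counit_def convolution_inverse_def by (metis (no_types, lifting))
qed (simp add: twisted_counit_def convolution_inverse_def)

text \<open>Both functionals equal \<open>(\<epsilon> \<otimes> \<epsilon>')\<Delta>\<^sub>\<Psi>\<close>: contract the right factor first, or the left one.\<close>

lemma twisted_counit_unique:
  assumes \<Psi>: "\<Psi> \<in> module_hom K CD (tensor K D C)"
    and \<epsilon>: "twisted_counit K C D \<Psi> \<epsilon>" and \<epsilon>': "twisted_counit K C D \<Psi> \<epsilon>'"
    and x: "x \<in> carrier CD"
  shows "\<epsilon> x = \<epsilon>' x"
proof -
  note mCD = tensor_module[OF C.module_axioms D.module_axioms]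
  have "\<epsilon> x = tensor_functional K CD CD \<epsilon> \<epsilon>' (twisted_comul K C D \<Psi> x)"
    using tensor_functional_props(4)[OF mCD mCD _ _ hom_closed[OF twisted_comul_linear[OF \<Psi>] x]]
      \<epsilon> \<epsilon>' x by (simp add: twisted_counit_def)
  also have "\<dots> = \<epsilon>' x"
    using tensor_functional_props(3)[OF mCD mCD _ _ hom_closed[OF twisted_comul_linear[OF \<Psi>] x]]
      \<epsilon> \<epsilon>' x by (simp add: twisted_counit_def)
  finally show ?thesis .
qed

end

theorem proposition4p6:
  fixes K :: "('k, 'x) ring_scheme"
    and C :: "('k, 'c, 'y) coalgebra_scheme"
    and D :: "('k, 'd, 'z) coalgebra_scheme"
    and \<Psi>' :: "('k, 'd, 'c) tensor \<Rightarrow> ('k, 'd, 'c) tensor"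
    and \<Psi> :: "('k, 'c, 'd) tensor \<Rightarrow> ('k, 'd, 'c) tensor"
    and \<phi> :: "('k, 'c, 'd) tensor \<Rightarrow> 'k"
  assumes "field K"
    and "coalgebra K C"
    and "coalgebra K D"
    and "\<Psi>' \<in> Tw K C D"
    and "\<Psi> = \<Psi>' \<circ> tensor_flip K C D"
    and "\<phi> = tensor_functional K D C (counit D) (counit C) \<circ> \<Psi>"
  shows "((\<exists>\<epsilon>. twisted_counit K C D \<Psi> \<epsilon>) \<longleftrightarrow> (\<exists>\<psi>. convolution_inverse K C D \<phi> \<psi>)) \<and>
    (\<forall>\<psi>. convolution_inverse K C D \<phi> \<psi> \<longrightarrow>
      twisted_counit K C D \<Psi> \<psi> \<and>
      (\<forall>\<epsilon>. twisted_counit K C D \<Psi> \<epsilon> \<longrightarrow> (\<forall>x\<in>carrier (tensor K C D). \<epsilon> x = \<psi> x)))"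
proof -
  interpret coalgebra_pair K C D using assms(2,3) by (rule coalgebra_pair.intro)
  note iff = twisted_counit_iff_convolution_inverse[OF assms(4-6)]
  have "\<Psi> \<in> module_hom K CD (tensor K D C)"
    using assms(4) unfolding assms(5) comp_def
    by (intro module_hom_comp[OF tensor_flip(1)[OF C.module_axioms D.module_axioms]])
      (simp add: Tw_def)
  note twisted_counit_unique[OF this]
  then show ?thesis by (auto simp flip: iff)
qed

end
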